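(* Let $n\ge2$ and let $(M_p)_{p\in\mathbb{N}}$ be a sequence of positive reals with $M_0=1$ satisfying $(M.0)$, $(M.1)$ and $(M.2)'$. Let $\ast$ be $\{M_p\}$ (Roumieu case) or $(M_p)$ (Beurling case). Then $f\in{\mathcal{E}^\ast}'(\mathbb{R}^n)$ is rotation invariant if and only if $f=f_S$, where $f_S$ is the spherical mean of $f$.
   Context: Conditions on the sequence: $(M.0)$: in the Roumieu case there are $C,\ell>0$ with $p!\le C\ell^pM_p$ for all $p\in\mathbb{N}$; in the Beurling case for each $\ell>0$ there is $C=C_\ell>0$ with $p!\le C\ell^pM_p$ for all $p$. $(M.1)$: $M_p^2\le M_{p-1}M_{p+1}$ for $p\ge1$. $(M.2)'$: there are $A,H>0$ with $M_{p+1}\le AH^pM_p$ for all $p\in\mathbb{N}$. Spaces. For $\Omega\subseteq\mathbb{R}^d$ open, $\mathcal{E}(\Omega)=C^\infty(\Omega)$. For $K\Subset\Omega$ (a compact subset with non-empty interior) and $h>0$, $\mathcal{E}^{\{M_p\},h}(K)$ is the space of $\varphi\in\mathcal{E}(\Omega)$ with $\|\varphi\|_{\mathcal{E}^{\{M_p\},h}(K)}=\sup_{x\in K,\alpha\in\mathbb{N}^d}\frac{|\varphi^{(\alpha)}(x)|}{h^{|\alpha|}M_{|\alpha|}}<\infty$. Then $\mathcal{E}^{\{M_p\}}(\Omega)=\varprojlim_{K\Subset\Omega}\varinjlim_{h\to\infty}\mathcal{E}^{\{M_p\},h}(K)$ and $\mathcal{E}^{(M_p)}(\Omega)=\varprojlim_{K\Subset\Omega}\varprojlim_{h\to0^+}\mathcal{E}^{\{M_p\},h}(K)$;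 ${\mathcal{E}^\ast}'(\Omega)$ is the topological dual. Rotation invariance: $f\in{\mathcal{E}^\ast}'(\mathbb{R}^n)$ is rotation invariant if $\langle f(x),\varphi(x)\rangle=\langle f(x),\varphi(T^{-1}x)\rangle$ for every $T\in SO(n)$ and every $\varphi\in\mathcal{E}^\ast(\mathbb{R}^n)$. Spherical mean: for $\varphi\in\mathcal{E}^\ast(\mathbb{R}^n)$, $\varphi_S(x)=\frac{1}{|\mathbb{S}^{n-1}|}\int_{\mathbb{S}^{n-1}}\varphi(|x|\omega)\,d\omega=\int_{SO(n)}\varphi(Tx)\,dT$ ($d\omega$ surface measure, $dT$ normalized Haar measure); the map $\varphi\mapsto\varphi_S$ is continuous from $\mathcal{E}^\ast(\mathbb{R}^n)$ into itself. The spherical mean $f_S\in{\mathcal{E}^\ast}'(\mathbb{R}^n)$ of $f\in{\mathcal{E}^\ast}'(\mathbb{R}^n)$ is defined by $\langle f_S,\varphi\rangle=\langle f,\varphi_S\rangle$. *)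

theory Defs
  imports "HOL-Analysis.Analysis"
begin

section \<open>Smooth functions and multi-index derivatives\<close>

definition partial_deriv ::
    "'n::finite \<Rightarrow> (real^'n \<Rightarrow> complex) \<Rightarrow> (real^'n \<Rightarrow> complex)" where
  "partial_deriv i f = (\<lambda>x. vector_derivative (\<lambda>t. f (x + t *\<^sub>R axis i 1)) (at 0))"

definition iterated_partial ::
    "'n::finite list \<Rightarrow> (real^'n \<Rightarrow> complex) \<Rightarrow> (real^'n \<Rightarrow> complex)" where
  "iterated_partial js f = foldr partial_deriv js f"

definition smooth :: "(real^'n \<Rightarrow> complex) \<Rightarrow> bool" where
  "smooth f \<longleftrightarrow> (\<forall>js x. iterated_partial js f differentiable (at x))"

text \<open>
  The index type carries no order, so the order in which the partial derivatives of a
  multi-index are taken is left to a choice; for smooth functions it is irrelevant.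
\<close>

definition multi_deriv ::
    "('n::finite \<Rightarrow> nat) \<Rightarrow> (real^'n \<Rightarrow> complex) \<Rightarrow> (real^'n \<Rightarrow> complex)" where
  "multi_deriv \<alpha> f = iterated_partial (SOME js. \<forall>i. count_list js i = \<alpha> i) f"

lemma multi_index_list_exists:
  fixes \<alpha> :: "'n::finite \<Rightarrow> nat"
  shows "\<exists>js. \<forall>i. count_list js i = \<alpha> i"
proof -
  have "\<exists>js. \<forall>i. count_list js i = (if i \<in> A then \<alpha> i else 0)" if "finite A" for A
    using that
  proof (induction A rule: finite_induct)
    case empty
    show ?case by (rule exI[of _ "[]"]) simp
  next
    case (insert a A)
    then obtain js where js: "\<forall>i. count_list js i = (if i \<in> A then \<alpha> i else 0)" by auto
    have rep: "count_list (replicate n a) i = (if i = a then n else 0)" for n i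
      by (induction n) auto
    have "\<forall>i. count_list (replicate (\<alpha> a) a @ js) i = (if i \<in> insert a A then \<alpha> i else 0)"
      using js insert.hyps by (auto simp: rep count_list_append)
    then show ?case by blast
  qed
  from this[OF finite[of UNIV]] show ?thesis by simp
qed

abbreviation multi_order :: "('n::finite \<Rightarrow> nat) \<Rightarrow> nat" where
  "multi_order \<alpha> \<equiv> (\<Sum>i\<in>UNIV. \<alpha> i)"


section \<open>Projective and inductive limits of function spaces\<close>

text \<open>
  A topological vector space of complex-valued functions is a topology whose \<^const>\<open>topspace\<close>
  is the space of functions; the vector operations are the pointwise ones. The connecting
  maps of all systems below are inclusions.
\<close>

definition absolutely_convex :: "('a \<Rightarrow> complex) set \<Rightarrow> bool" where
  "absolutely_convex V \<longleftrightarrow>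
     (\<forall>u\<in>V. \<forall>v\<in>V. \<forall>a b. cmod a + cmod b \<le> 1 \<longrightarrow> (\<lambda>x. a * u x + b * v x) \<in> V)"

text \<open>Initial topology on the intersection of the spaces.\<close>

definition proj_lim :: "'i set \<Rightarrow> ('i \<Rightarrow> ('a \<Rightarrow> complex) topology) \<Rightarrow> ('a \<Rightarrow> complex) topology" where
  "proj_lim I F = topology_generated_by
     {U \<inter> (\<Inter>i\<in>I. topspace (F i)) | i U. i \<in> I \<and> openin (F i) U}"

text \<open>
  Finest locally convex topology on the union of the (directed) spaces for which all
  inclusions are continuous: the absolutely convex sets whose trace on every step is a
  neighbourhood of zero form a base of neighbourhoods of zero.
\<close>

definition ind_lim_nhd0 ::
    "'i set \<Rightarrow> ('i \<Rightarrow> ('a \<Rightarrow> complex) topology) \<Rightarrow> ('a \<Rightarrow> complex) set \<Rightarrow> bool" where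
  "ind_lim_nhd0 I F V \<longleftrightarrow>
     V \<subseteq> (\<Union>i\<in>I. topspace (F i)) \<and> absolutely_convex V \<and>
     (\<forall>i\<in>I. \<exists>W. openin (F i) W \<and> (\<lambda>_. 0) \<in> W \<and> W \<subseteq> V)"

definition ind_lim :: "'i set \<Rightarrow> ('i \<Rightarrow> ('a \<Rightarrow> complex) topology) \<Rightarrow> ('a \<Rightarrow> complex) topology" where
  "ind_lim I F = topology (\<lambda>U. U \<subseteq> (\<Union>i\<in>I. topspace (F i)) \<and>
     (\<forall>u\<in>U. \<exists>V. ind_lim_nhd0 I F V \<and> (\<forall>v\<in>V. (\<lambda>x. u x + v x) \<in> U)))"

lemma ind_lim_nhd0_Int:
  assumes "ind_lim_nhd0 I F V" "ind_lim_nhd0 I F W"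
  shows "ind_lim_nhd0 I F (V \<inter> W)"
proof -
  have "\<exists>Z. openin (F i) Z \<and> (\<lambda>_. 0) \<in> Z \<and> Z \<subseteq> V \<inter> W" if i: "i \<in> I" for i
  proof -
    obtain A where A: "openin (F i) A" "(\<lambda>_. 0) \<in> A" "A \<subseteq> V"
      using assms(1) i unfolding ind_lim_nhd0_def by blast
    obtain B where B: "openin (F i) B" "(\<lambda>_. 0) \<in> B" "B \<subseteq> W"
      using assms(2) i unfolding ind_lim_nhd0_def by blast
    show ?thesis by (rule exI[of _ "A \<inter> B"]) (use A B in auto)
  qed
  moreover have "absolutely_convex (V \<inter> W)"
    using assms unfolding ind_lim_nhd0_def absolutely_convex_def by auto
  ultimately show ?thesis using assms unfolding ind_lim_nhd0_def by blast
qed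

lemma openin_ind_lim:
  "openin (ind_lim I F) U \<longleftrightarrow> U \<subseteq> (\<Union>i\<in>I. topspace (F i)) \<and>
     (\<forall>u\<in>U. \<exists>V. ind_lim_nhd0 I F V \<and> (\<forall>v\<in>V. (\<lambda>x. u x + v x) \<in> U))"
proof -
  have "istopology (\<lambda>U. U \<subseteq> (\<Union>i\<in>I. topspace (F i)) \<and>
     (\<forall>u\<in>U. \<exists>V. ind_lim_nhd0 I F V \<and> (\<forall>v\<in>V. (\<lambda>x. u x + v x) \<in> U)))" (is "istopology ?P")
    unfolding istopology_def
  proof (intro conjI allI impI)
    fix S T assume S: "?P S" and T: "?P T"
    show "S \<inter> T \<subseteq> (\<Union>i\<in>I. topspace (F i))" using S by blast
    show "\<forall>u\<in>S \<inter> T. \<exists>V. ind_lim_nhd0 I F V \<and> (\<forall>v\<in>V. (\<lambda>x. u x + v x) \<in> S \<inter> T)"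
    proof
      fix u assume u: "u \<in> S \<inter> T"
      obtain V where V: "ind_lim_nhd0 I F V" "\<forall>v\<in>V. (\<lambda>x. u x + v x) \<in> S"
        using S u by blast
      obtain W where W: "ind_lim_nhd0 I F W" "\<forall>v\<in>W. (\<lambda>x. u x + v x) \<in> T"
        using T u by blast
      show "\<exists>V. ind_lim_nhd0 I F V \<and> (\<forall>v\<in>V. (\<lambda>x. u x + v x) \<in> S \<inter> T)"
        using ind_lim_nhd0_Int[OF V(1) W(1)] V(2) W(2) by blast
    qed
  next
    fix \<K> assume K: "\<forall>K\<in>\<K>. ?P K"
    show "\<Union>\<K> \<subseteq> (\<Union>i\<in>I. topspace (F i))" using K by blast
    show "\<forall>u\<in>\<Union>\<K>. \<exists>V. ind_lim_nhd0 I F V \<and> (\<forall>v\<in>V. (\<lambda>x. u x + v x) \<in> \<Union>\<K>)"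
    proof
      fix u assume "u \<in> \<Union>\<K>"
      then obtain S where S: "S \<in> \<K>" "u \<in> S" by blast
      then obtain V where "ind_lim_nhd0 I F V" "\<forall>v\<in>V. (\<lambda>x. u x + v x) \<in> S" using K by blast
      with S show "\<exists>V. ind_lim_nhd0 I F V \<and> (\<forall>v\<in>V. (\<lambda>x. u x + v x) \<in> \<Union>\<K>)" by blast
    qed
  qed
  then show ?thesis unfolding ind_lim_def by (simp add: topology_inverse')
qed

lemma topspace_proj_lim:
  assumes "I \<noteq> {}"
  shows "topspace (proj_lim I F) = (\<Inter>i\<in>I. topspace (F i))"
proof -
  have "topspace (proj_lim I F)
      = \<Union>{U \<inter> (\<Inter>i\<in>I. topspace (F i)) | i U. i \<in> I \<and> openin (F i) U}"
    unfolding proj_lim_def by (rule topology_generated_by_topspace)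
  also have "\<dots> = (\<Inter>i\<in>I. topspace (F i))" using assms openin_topspace by blast
  finally show ?thesis .
qed


section \<open>Ultradifferentiable functions and ultradistributions of compact support\<close>

datatype ultra_case = Roumieu | Beurling

fun M0 :: "ultra_case \<Rightarrow> (nat \<Rightarrow> real) \<Rightarrow> bool" where
  "M0 Roumieu M \<longleftrightarrow> (\<exists>C>0. \<exists>l>0. \<forall>p. fact p \<le> C * l ^ p * M p)"
| "M0 Beurling M \<longleftrightarrow> (\<forall>l>0. \<exists>C>0. \<forall>p. fact p \<le> C * l ^ p * M p)"

definition M1 :: "(nat \<Rightarrow> real) \<Rightarrow> bool" where
  "M1 M \<longleftrightarrow> (\<forall>p\<ge>1. (M p)\<^sup>2 \<le> M (p - 1) * M (p + 1))"

definition M2' :: "(nat \<Rightarrow> real) \<Rightarrow> bool" where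
  "M2' M \<longleftrightarrow> (\<exists>A>0. \<exists>H>0. \<forall>p. M (p + 1) \<le> A * H ^ p * M p)"

definition ultra_norm ::
    "(nat \<Rightarrow> real) \<Rightarrow> (real^'n) set \<Rightarrow> real \<Rightarrow> (real^'n \<Rightarrow> complex) \<Rightarrow> ennreal" where
  "ultra_norm M K h \<phi> = (SUP x\<in>K. SUP \<alpha>.
     ennreal (cmod (multi_deriv \<alpha> \<phi> x) / (h ^ multi_order \<alpha> * M (multi_order \<alpha>))))"

definition ultra_step_space ::
    "(nat \<Rightarrow> real) \<Rightarrow> (real^'n) set \<Rightarrow> real \<Rightarrow> (real^'n \<Rightarrow> complex) set" where
  "ultra_step_space M K h = {\<phi>. smooth \<phi> \<and> ultra_norm M K h \<phi> < \<infinity>}"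

definition ultra_step ::
    "(nat \<Rightarrow> real) \<Rightarrow> (real^'n) set \<Rightarrow> real \<Rightarrow> (real^'n \<Rightarrow> complex) topology" where
  "ultra_step M K h = topology (\<lambda>U. U \<subseteq> ultra_step_space M K h \<and>
     (\<forall>\<phi>\<in>U. \<exists>\<epsilon>>0. \<forall>\<psi>\<in>ultra_step_space M K h.
        ultra_norm M K h (\<lambda>x. \<psi> x - \<phi> x) < ennreal \<epsilon> \<longrightarrow> \<psi> \<in> U))"

lemma openin_ultra_step:
  "openin (ultra_step M K h) U \<longleftrightarrow> U \<subseteq> ultra_step_space M K h \<and>
     (\<forall>\<phi>\<in>U. \<exists>\<epsilon>>0. \<forall>\<psi>\<in>ultra_step_space M K h.
        ultra_norm M K h (\<lambda>x. \<psi> x - \<phi> x) < ennreal \<epsilon> \<longrightarrow> \<psi> \<in> U)"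
proof -
  have "istopology (\<lambda>U. U \<subseteq> ultra_step_space M K h \<and>
     (\<forall>\<phi>\<in>U. \<exists>\<epsilon>>0. \<forall>\<psi>\<in>ultra_step_space M K h.
        ultra_norm M K h (\<lambda>x. \<psi> x - \<phi> x) < ennreal \<epsilon> \<longrightarrow> \<psi> \<in> U))" (is "istopology ?P")
    unfolding istopology_def
  proof (intro conjI allI impI)
    fix S T assume S: "?P S" and T: "?P T"
    show "S \<inter> T \<subseteq> ultra_step_space M K h" using S by blast
    show "\<forall>\<phi>\<in>S \<inter> T. \<exists>\<epsilon>>0. \<forall>\<psi>\<in>ultra_step_space M K h.
        ultra_norm M K h (\<lambda>x. \<psi> x - \<phi> x) < ennreal \<epsilon> \<longrightarrow> \<psi> \<in> S \<inter> T"
    proof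
      fix \<phi> assume \<phi>: "\<phi> \<in> S \<inter> T"
      obtain d where d: "d > 0" "\<forall>\<psi>\<in>ultra_step_space M K h.
        ultra_norm M K h (\<lambda>x. \<psi> x - \<phi> x) < ennreal d \<longrightarrow> \<psi> \<in> S" using S \<phi> by blast
      obtain e where e: "e > 0" "\<forall>\<psi>\<in>ultra_step_space M K h.
        ultra_norm M K h (\<lambda>x. \<psi> x - \<phi> x) < ennreal e \<longrightarrow> \<psi> \<in> T" using T \<phi> by blast
      have "z < ennreal d" "z < ennreal e" if "z < ennreal (min d e)" for z
        using that d(1) e(1) by (auto intro: less_le_trans ennreal_leI)
      then show "\<exists>\<epsilon>>0. \<forall>\<psi>\<in>ultra_step_space M K h.
        ultra_norm M K h (\<lambda>x. \<psi> x - \<phi> x) < ennreal \<epsilon> \<longrightarrow> \<psi> \<in> S \<inter> T"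
        using d e by (intro exI[of _ "min d e"]) auto
    qed
  next
    fix \<K> assume K: "\<forall>S\<in>\<K>. ?P S"
    show "\<Union>\<K> \<subseteq> ultra_step_space M K h" using K by blast
    show "\<forall>\<phi>\<in>\<Union>\<K>. \<exists>\<epsilon>>0. \<forall>\<psi>\<in>ultra_step_space M K h.
        ultra_norm M K h (\<lambda>x. \<psi> x - \<phi> x) < ennreal \<epsilon> \<longrightarrow> \<psi> \<in> \<Union>\<K>"
    proof
      fix \<phi> assume "\<phi> \<in> \<Union>\<K>"
      then obtain S where S: "S \<in> \<K>" "\<phi> \<in> S" by blast
      then obtain e where "e > 0" "\<forall>\<psi>\<in>ultra_step_space M K h.
        ultra_norm M K h (\<lambda>x. \<psi> x - \<phi> x) < ennreal e \<longrightarrow> \<psi> \<in> S" using K by blast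
      with S show "\<exists>\<epsilon>>0. \<forall>\<psi>\<in>ultra_step_space M K h.
        ultra_norm M K h (\<lambda>x. \<psi> x - \<phi> x) < ennreal \<epsilon> \<longrightarrow> \<psi> \<in> \<Union>\<K>" by blast
    qed
  qed
  then show ?thesis unfolding ultra_step_def by (simp add: topology_inverse')
qed

lemma topspace_ultra_step: "topspace (ultra_step M K h) = ultra_step_space M K h"
proof
  show "topspace (ultra_step M K h) \<subseteq> ultra_step_space M K h"
    using openin_topspace[of "ultra_step M K h"] unfolding openin_ultra_step by blast
  have "openin (ultra_step M K h) (ultra_step_space M K h)"
    unfolding openin_ultra_step by (auto intro: exI[of _ 1])
  then show "ultra_step_space M K h \<subseteq> topspace (ultra_step M K h)" by (rule openin_subset)
qed

definition fat_compacts :: "'a::topological_space set set" where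
  "fat_compacts = {K. compact K \<and> interior K \<noteq> {}}"

fun ultra_space :: "ultra_case \<Rightarrow> (nat \<Rightarrow> real) \<Rightarrow> (real^'n \<Rightarrow> complex) topology" where
  "ultra_space Roumieu M = proj_lim fat_compacts (\<lambda>K. ind_lim {0<..} (ultra_step M K))"
| "ultra_space Beurling M = proj_lim fat_compacts (\<lambda>K. proj_lim {0<..} (ultra_step M K))"

lemma iterated_partial_linear:
  assumes "smooth f" "smooth g"
  shows "iterated_partial js (\<lambda>x. a * f x + b * g x)
    = (\<lambda>x. a * iterated_partial js f x + b * iterated_partial js g x)"
proof (induction js)
  case Nil
  then show ?case by (simp add: iterated_partial_def)
next
  case (Cons i js)
  have D: "((\<lambda>t. iterated_partial js u (x + t *\<^sub>R axis i 1)) has_vector_derivative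
      partial_deriv i (iterated_partial js u) x) (at 0)" if "smooth u" for u x
  proof -
    have "(iterated_partial js u \<circ> (\<lambda>t. x + t *\<^sub>R axis i 1)) differentiable (at (0::real))"
      using that by (intro differentiable_chain_at derivative_intros) (auto simp: smooth_def)
    then show ?thesis by (simp add: partial_deriv_def o_def vector_derivative_works)
  qed
  have "((\<lambda>t. a * iterated_partial js f (x + t *\<^sub>R axis i 1)
        + b * iterated_partial js g (x + t *\<^sub>R axis i 1)) has_vector_derivative
      a * partial_deriv i (iterated_partial js f) x + b * partial_deriv i (iterated_partial js g) x)
      (at 0)" for x
    by (intro has_vector_derivative_add has_vector_derivative_mult_right D assms)
  then have "partial_deriv i (\<lambda>x. a * iterated_partial js f x + b * iterated_partial js g x) x
      = a * partial_deriv i (iterated_partial js f) x + b * partial_deriv i (iterated_partial js g) x" for x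
    unfolding partial_deriv_def[of i "\<lambda>x. a * iterated_partial js f x + b * iterated_partial js g x"]
    by (rule vector_derivative_at)
  moreover have "iterated_partial (i # js) u = partial_deriv i (iterated_partial js u)" for u :: "real^'a \<Rightarrow> complex"
    by (simp add: iterated_partial_def)
  ultimately show ?case by (simp add: Cons.IH fun_eq_iff)
qed

lemma smooth_linear:
  assumes "smooth f" "smooth g"
  shows "smooth (\<lambda>x. a * f x + b * g x)"
  using assms unfolding smooth_def iterated_partial_linear[OF assms]
  by (intro allI derivative_intros) auto

lemma ultra_norm_finite_iff:
  assumes "\<And>p. M p > 0" "h > 0"
  shows "ultra_norm M K h \<phi> < \<infinity> \<longleftrightarrow> (\<exists>B\<ge>0. \<forall>x\<in>K. \<forall>\<alpha>.
    cmod (multi_deriv \<alpha> \<phi> x) \<le> B * (h ^ multi_order \<alpha> * M (multi_order \<alpha>)))" (is "_ \<longleftrightarrow> ?R")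
proof
  have pos: "h ^ multi_order \<alpha> * M (multi_order \<alpha>) > 0" for \<alpha> :: "'a \<Rightarrow> nat"
    using assms by simp
  have "ultra_norm M K h \<phi> \<le> ennreal B \<longleftrightarrow> (\<forall>x\<in>K. \<forall>\<alpha>.
      cmod (multi_deriv \<alpha> \<phi> x) \<le> B * (h ^ multi_order \<alpha> * M (multi_order \<alpha>)))" if "B \<ge> 0" for B
    unfolding ultra_norm_def SUP_le_iff using that pos
    by (simp add: pos_divide_le_eq)
  note * = this
  show ?R if "ultra_norm M K h \<phi> < \<infinity>"
  proof -
    obtain B where "B \<ge> 0" "ultra_norm M K h \<phi> = ennreal B"
      using \<open>ultra_norm M K h \<phi> < \<infinity>\<close> by (cases "ultra_norm M K h \<phi>") auto
    with *[of B] show ?R by auto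
  qed
  show "ultra_norm M K h \<phi> < \<infinity>" if R: ?R
  proof -
    obtain B where "B \<ge> 0" "\<forall>x\<in>K. \<forall>\<alpha>.
        cmod (multi_deriv \<alpha> \<phi> x) \<le> B * (h ^ multi_order \<alpha> * M (multi_order \<alpha>))"
      using R by auto
    then have "ultra_norm M K h \<phi> \<le> ennreal B" using * by simp
    also have "\<dots> < \<infinity>" by simp
    finally show ?thesis .
  qed
qed

lemma absolutely_convex_Union_steps:
  assumes M: "\<And>p. M p > 0"
  shows "absolutely_convex (\<Union>h\<in>{0<..}. ultra_step_space M K h)"
  unfolding absolutely_convex_def
proof (intro ballI allI impI)
  fix u v and a b :: complex
  assume "u \<in> (\<Union>h\<in>{0<..}. ultra_step_space M K h)" "v \<in> (\<Union>h\<in>{0<..}. ultra_step_space M K h)"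
  then obtain h k where h: "h > 0" "u \<in> ultra_step_space M K h" and k: "k > 0" "v \<in> ultra_step_space M K k"
    by auto
  then have sm: "smooth u" "smooth v" by (auto simp: ultra_step_space_def)
  obtain B where B: "B \<ge> 0" "\<And>x \<alpha>. x \<in> K \<Longrightarrow>
      cmod (multi_deriv \<alpha> u x) \<le> B * (h ^ multi_order \<alpha> * M (multi_order \<alpha>))"
    using h ultra_norm_finite_iff[of M h K u, OF M] by (auto simp: ultra_step_space_def)
  obtain C where C: "C \<ge> 0" "\<And>x \<alpha>. x \<in> K \<Longrightarrow>
      cmod (multi_deriv \<alpha> v x) \<le> C * (k ^ multi_order \<alpha> * M (multi_order \<alpha>))"
    using k ultra_norm_finite_iff[of M k K v, OF M] by (auto simp: ultra_step_space_def)
  define m where "m = max h k"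
  have m: "m > 0" using h by (simp add: m_def)
  have "cmod (multi_deriv \<alpha> (\<lambda>x. a * u x + b * v x) x)
      \<le> (cmod a * B + cmod b * C) * (m ^ multi_order \<alpha> * M (multi_order \<alpha>))" if x: "x \<in> K" for x \<alpha>
  proof -
    let ?p = "multi_order \<alpha>"
    have "cmod (multi_deriv \<alpha> (\<lambda>x. a * u x + b * v x) x)
        \<le> cmod a * cmod (multi_deriv \<alpha> u x) + cmod b * cmod (multi_deriv \<alpha> v x)"
      unfolding multi_deriv_def iterated_partial_linear[OF sm]
      by (rule order_trans[OF norm_triangle_ineq]) (simp add: norm_mult)
    also have "\<dots> \<le> cmod a * (B * (h ^ ?p * M ?p)) + cmod b * (C * (k ^ ?p * M ?p))"
      using B C x by (intro add_mono mult_left_mono) auto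
    also have "\<dots> \<le> cmod a * (B * (m ^ ?p * M ?p)) + cmod b * (C * (m ^ ?p * M ?p))"
      using B(1) C(1) h(1) k(1) M[of ?p]
      by (intro add_mono mult_left_mono mult_right_mono power_mono) (auto simp: m_def)
    finally show ?thesis by (simp add: algebra_simps)
  qed
  moreover have "cmod a * B + cmod b * C \<ge> 0" using B C by simp
  ultimately have "ultra_norm M K m (\<lambda>x. a * u x + b * v x) < \<infinity>"
    unfolding ultra_norm_finite_iff[of M m K "\<lambda>x. a * u x + b * v x", OF M m]
    by (intro exI[of _ "cmod a * B + cmod b * C"]) simp
  then show "(\<lambda>x. a * u x + b * v x) \<in> (\<Union>h\<in>{0<..}. ultra_step_space M K h)"
    using m smooth_linear[OF sm] by (auto simp: ultra_step_space_def)
qed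

lemma zero_in_ultra_step_space: "(\<lambda>_. 0) \<in> ultra_step_space M K h"
proof -
  have *: "iterated_partial js (\<lambda>_. 0) = (\<lambda>_. 0)" for js :: "'a list"
    by (induction js) (auto simp: iterated_partial_def partial_deriv_def)
  have "ultra_norm M K h (\<lambda>_. 0) \<le> 0"
    unfolding ultra_norm_def multi_deriv_def * SUP_le_iff by simp
  then show ?thesis by (simp add: ultra_step_space_def smooth_def *)
qed

lemma fat_compacts_nonempty: "fat_compacts \<noteq> ({} :: (real^'n) set set)"
proof -
  have "cball 0 1 \<in> (fat_compacts :: (real^'n) set set)"
    by (simp add: fat_compacts_def interior_cball)
  then show ?thesis by blast
qed

lemma topspace_ultra_space:
  assumes M: "\<And>p. M p > 0"
  shows "topspace (ultra_space Roumieu M :: (real^'n \<Rightarrow> complex) topology) =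
           (\<Inter>K\<in>fat_compacts. \<Union>h\<in>{0<..}. ultra_step_space M K h)"
    and "topspace (ultra_space Beurling M :: (real^'n \<Rightarrow> complex) topology) =
           (\<Inter>K\<in>fat_compacts. \<Inter>h\<in>{0<..}. ultra_step_space M K h)"
proof -
  have "topspace (ind_lim {0<..} (ultra_step M K)) = (\<Union>h\<in>{0<..}. ultra_step_space M K h)"
    (is "_ = ?X") for K :: "(real^'n) set"
  proof
    have "openin (ind_lim {0<..} (ultra_step M K)) (topspace (ind_lim {0<..} (ultra_step M K)))"
      by simp
    then show "topspace (ind_lim {0<..} (ultra_step M K)) \<subseteq> ?X"
      unfolding openin_ind_lim topspace_ultra_step by blast
    have abs: "absolutely_convex ?X" by (rule absolutely_convex_Union_steps[OF M])
    have dbl: "(\<lambda>x. u x + v x) \<in> ?X" if uv: "u \<in> ?X" "v \<in> ?X" for u v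
    proof -
      have "(\<lambda>x. 2 * w x) \<in> ?X" if w: "w \<in> ?X" for w
      proof -
        obtain h where h: "h > 0" "w \<in> ultra_step_space M K h" using w by auto
        then have sm: "smooth w" by (simp add: ultra_step_space_def)
        obtain B where B: "B \<ge> 0" "\<And>x \<alpha>. x \<in> K \<Longrightarrow>
            cmod (multi_deriv \<alpha> w x) \<le> B * (h ^ multi_order \<alpha> * M (multi_order \<alpha>))"
          using h ultra_norm_finite_iff[of M h K w, OF M] by (auto simp: ultra_step_space_def)
        have "multi_deriv \<alpha> (\<lambda>x. 2 * w x) x = 2 * multi_deriv \<alpha> w x" for x \<alpha>
          using iterated_partial_linear[OF sm sm, of _ 2 0] by (simp add: multi_deriv_def)
        then have "\<forall>x\<in>K. \<forall>\<alpha>. cmod (multi_deriv \<alpha> (\<lambda>x. 2 * w x) x)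
            \<le> (2 * B) * (h ^ multi_order \<alpha> * M (multi_order \<alpha>))"
          using B by (simp add: norm_mult)
        then have "ultra_norm M K h (\<lambda>x. 2 * w x) < \<infinity>"
          unfolding ultra_norm_finite_iff[of M h K "\<lambda>x. 2 * w x", OF M h(1)]
          using B(1) by (intro exI[of _ "2 * B"]) simp
        moreover have "smooth (\<lambda>x. 2 * w x)" using smooth_linear[OF sm sm, of 2 0] by simp
        ultimately show ?thesis using h by (auto simp: ultra_step_space_def)
      qed
      then have "(\<lambda>x. (1/2::complex) * (2 * u x) + (1/2) * (2 * v x)) \<in> ?X"
        using uv by (intro abs[unfolded absolutely_convex_def, rule_format]) (auto simp: norm_divide)
      then show ?thesis by simp
    qed
    have "ind_lim_nhd0 {0<..} (ultra_step M K) ?X"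
      unfolding ind_lim_nhd0_def topspace_ultra_step
    proof (intro conjI ballI)
      fix h :: real assume "h \<in> {0<..}"
      then show "\<exists>W. openin (ultra_step M K h) W \<and> (\<lambda>_. 0) \<in> W \<and> W \<subseteq> ?X"
        using openin_topspace[of "ultra_step M K h"] zero_in_ultra_step_space[of M K h]
        unfolding topspace_ultra_step by blast
    qed (use abs in auto)
    then have "openin (ind_lim {0<..} (ultra_step M K)) ?X"
      unfolding openin_ind_lim topspace_ultra_step using dbl by blast
    then show "?X \<subseteq> topspace (ind_lim {0<..} (ultra_step M K))" by (rule openin_subset)
  qed
  then show "topspace (ultra_space Roumieu M :: (real^'n \<Rightarrow> complex) topology) =
      (\<Inter>K\<in>fat_compacts. \<Union>h\<in>{0<..}. ultra_step_space M K h)"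
    by (simp add: topspace_proj_lim fat_compacts_nonempty)
  have "{0::real<..} \<noteq> {}" by (simp add: greaterThan_non_empty)
  then show "topspace (ultra_space Beurling M :: (real^'n \<Rightarrow> complex) topology) =
      (\<Inter>K\<in>fat_compacts. \<Inter>h\<in>{0<..}. ultra_step_space M K h)"
    by (simp add: topspace_proj_lim fat_compacts_nonempty topspace_ultra_step)
qed

text \<open>
  Functionals are taken extensional, so that equality in the dual is equality of functions.
\<close>

definition top_dual :: "('a \<Rightarrow> complex) topology \<Rightarrow> (('a \<Rightarrow> complex) \<Rightarrow> complex) set" where
  "top_dual X = {f. f \<in> extensional (topspace X) \<and>
     (\<forall>\<phi>\<in>topspace X. \<forall>\<psi>\<in>topspace X. f (\<lambda>x. \<phi> x + \<psi> x) = f \<phi> + f \<psi>) \<and>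
     (\<forall>c. \<forall>\<phi>\<in>topspace X. f (\<lambda>x. c * \<phi> x) = c * f \<phi>) \<and>
     continuous_map X euclidean f}"


section \<open>Rotation invariance and spherical means\<close>

definition rotation_invariant ::
    "(real^'n \<Rightarrow> complex) topology \<Rightarrow> ((real^'n \<Rightarrow> complex) \<Rightarrow> complex) \<Rightarrow> bool" where
  "rotation_invariant X f \<longleftrightarrow>
     (\<forall>T. rotation_matrix T \<longrightarrow> (\<forall>\<phi>\<in>topspace X. f \<phi> = f (\<lambda>x. \<phi> (matrix_inv T *v x))))"

text \<open>
  Surface measure of the unit sphere: a Borel set \<open>A\<close> of the sphere has measure
  \<open>n\<close> times the volume of the cone \<open>{r \<omega> | 0 < r < 1, \<omega> \<in> A}\<close>.
\<close>

definition surface_measure :: "(real^'n) measure" where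
  "surface_measure = scale_measure (of_nat CARD('n))
     (distr (restrict_space lborel (ball 0 1 - {0})) (restrict_space borel (sphere 0 1))
        (\<lambda>x. x /\<^sub>R norm x))"

lemma space_surface_measure: "space surface_measure = sphere 0 1"
  by (simp add: surface_measure_def space_scale_measure space_restrict_space)

lemma emeasure_surface_measure:
  fixes A :: "(real^'n) set"
  assumes "A \<in> sets borel" "A \<subseteq> sphere 0 1"
  shows "emeasure surface_measure A
    = of_nat CARD('n) * emeasure lborel {r *\<^sub>R \<omega> | r \<omega>. 0 < r \<and> r < 1 \<and> \<omega> \<in> A}"
proof -
  let ?B = "ball 0 1 - {0} :: (real^'n) set"
  have meas: "(\<lambda>x. x /\<^sub>R norm x) \<in>
      restrict_space lborel ?B \<rightarrow>\<^sub>M restrict_space borel (sphere 0 1 :: (real^'n) set)"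
    by (rule measurable_restrict_space2)
      (auto simp: space_restrict_space intro!: measurable_restrict_space1)
  have A: "A \<in> sets (restrict_space borel (sphere 0 1))"
    using assms by (auto simp: sets_restrict_space_iff)
  have eq: "(\<lambda>x. x /\<^sub>R norm x) -` A \<inter> ?B = {r *\<^sub>R \<omega> | r \<omega>. 0 < r \<and> r < 1 \<and> \<omega> \<in> A}" (is "?L = ?R")
  proof
    show "?L \<subseteq> ?R"
    proof
      fix x assume x: "x \<in> ?L"
      then have "x = norm x *\<^sub>R (x /\<^sub>R norm x)" "0 < norm x" "norm x < 1" "x /\<^sub>R norm x \<in> A"
        by auto
      then show "x \<in> ?R" by blast
    qed
    show "?R \<subseteq> ?L" using assms(2) by (auto simp: dist_norm subset_iff)
  qed
  have "emeasure (restrict_space lborel ?B) ?L = emeasure lborel ?L"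
    by (rule emeasure_restrict_space) auto
  then show ?thesis
    unfolding surface_measure_def using A meas
    by (simp add: emeasure_distr space_restrict_space eq)
qed

definition spherical_mean :: "(real^'n \<Rightarrow> complex) \<Rightarrow> (real^'n \<Rightarrow> complex)" where
  "spherical_mean \<phi> = (\<lambda>x. (1 / measure surface_measure (sphere 0 1 :: (real^'n) set)) *\<^sub>R
     (LINT \<omega>|surface_measure. \<phi> (norm x *\<^sub>R \<omega>)))"

definition spherical_mean_functional ::
    "(real^'n \<Rightarrow> complex) topology \<Rightarrow> ((real^'n \<Rightarrow> complex) \<Rightarrow> complex) \<Rightarrow>
     ((real^'n \<Rightarrow> complex) \<Rightarrow> complex)" where
  "spherical_mean_functional X f = (\<lambda>\<phi>\<in>topspace X. f (spherical_mean \<phi>))"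

end

theory Submission
  imports Defs
begin

text \<open>
  The spherical mean of \<open>\<phi>\<close> is a limit, in the space of test functions, of finite averages of
  rotates of \<open>\<phi>\<close>. A rotation invariant functional \<open>f\<close> takes the value \<open>f \<phi>\<close> on all these
  averages, so continuity gives \<open>f \<phi> = f (spherical_mean \<phi>)\<close>. Conversely, the surface measure is
  rotation invariant, hence \<open>\<phi>\<close> and its rotates have the same spherical mean, and a functional
  that factors through the spherical mean cannot distinguish them.

  Suitable averages exist by a variational argument that replaces integration over the rotation
  group. Let \<open>H\<close> be the \<open>rotation_hull\<close>, the closure of the set of rotates of \<open>\<phi>\<close> under midpoints.
  Its members share the spherical mean of \<open>\<phi>\<close>, and their partial derivatives of order \<open>p\<close> on a
  centred ball of \<open>\<real>\<^sup>n\<close> are bounded by \<open>n ^ p\<close> times those of \<open>\<phi>\<close>. Take a sequence \<open>g k\<close> in \<open>H\<close> that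
  minimizes a weighted sum, over all \<open>m\<close>, of the integrals of \<open>\<bar>u\<bar>\<^sup>2\<close> over the balls of radius
  \<open>m\<close>. The parallelogram law makes it a Cauchy sequence in the mean square over every ball
  (\<open>minimizing_sequence\<close>). Since \<open>H\<close> is equi-Lipschitz on balls, the sequence is locally
  uniformly Cauchy (\<open>uniformly_small_of_ball_energy\<close>), and since all derivatives are locally
  bounded on \<open>H\<close>, interpolation extends this to all derivatives
  (\<open>norm_partial_deriv_interpolation\<close>, \<open>smooth_limit\<close>). The rotated sequence is minimizing as well
  and stays close to \<open>g k\<close>; therefore the limit is a radial function, which equals its own
  spherical mean and hence that of \<open>\<phi>\<close> (\<open>spherical_mean_approximation\<close>).

  Derivative by derivative convergence becomes convergence in the space of test functions because
  the bounds \<open>B * (h ^ p * M p)\<close> are uniform along the sequence: in the norm with parameter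
  \<open>2 * h\<close> the derivatives of high order carry a factor \<open>(1/2) ^ p\<close>, and only finitely many orders
  remain (\<open>ultra_bound_tail_eventually\<close>). The losses from \<open>h\<close> to \<open>n * h\<close> and to \<open>2 * h\<close> are
  harmless both when \<open>h\<close> is existentially and when it is universally quantified
  (\<open>for_steps_rescale\<close>), which treats the Roumieu and the Beurling case together.
\<close>

section \<open>Rotation invariance of Lebesgue measure and of the surface measure\<close>

text \<open>
  Uniqueness of translation invariant measures. Let \<open>e\<close> be the indicator function of the unit
  ball. Since \<open>T\<close> preserves the ball, \<open>\<integral>\<integral> 1\<^sub>A(x) e(T y) dx dy\<close> is the volume of the ball times the
  Lebesgue measure of \<open>A\<close>. Translating the variables and interchanging the integrals turns it
  into the volume of the ball times the image measure of \<open>A\<close>.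
\<close>

lemma distr_orthogonal_lborel:
  fixes T :: "'a::euclidean_space \<Rightarrow> 'a"
  assumes T: "orthogonal_transformation T"
  shows "distr lborel borel T = lborel"
proof (rule measure_eqI)
  show "sets (distr lborel borel T) = sets lborel" by simp
  fix A assume "A \<in> sets (distr lborel borel T)"
  then have A [measurable]: "A \<in> sets borel" by simp
  interpret T: linear T using T by (rule orthogonal_transformation_linear)
  have normT: "norm (T x) = norm x" for x using T by (rule orthogonal_transformation_norm)
  have "continuous_on UNIV T" by (intro linear_continuous_on T.linear_axioms linear_conv_bounded_linear[THEN iffD1])
  then have T_meas [measurable]: "T \<in> borel_measurable borel" by (rule borel_measurable_continuous_onI)
  define \<nu> where "\<nu> = distr lborel borel T"
  have sets_\<nu> [measurable_cong, simp]: "sets \<nu> = sets borel" by (simp add: \<nu>_def)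
  have transl: "(\<integral>\<^sup>+x. u (c + x) \<partial>lborel) = (\<integral>\<^sup>+x. u x \<partial>lborel)"
    if [measurable]: "u \<in> borel_measurable borel" for u :: "'a \<Rightarrow> ennreal" and c
    by (subst (2) lborel_distr_plus[of c, symmetric]) (simp add: nn_integral_distr)
  have nn_\<nu>: "(\<integral>\<^sup>+x. u x \<partial>\<nu>) = (\<integral>\<^sup>+x. u (T x) \<partial>lborel)"
    if [measurable]: "u \<in> borel_measurable borel" for u :: "'a \<Rightarrow> ennreal"
    by (simp add: \<nu>_def nn_integral_distr)
  define e where "e y = (indicator (ball 0 1) y :: ennreal)" for y :: 'a
  have e [measurable]: "e \<in> borel_measurable borel" unfolding e_def[abs_def] by (intro borel_measurable_indicator) simp
  have e_T: "e (T y - x) = e (y - inv T x)" for x y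
  proof -
    have "T y - x = T (y - inv T x)"
      using orthogonal_transformation_surj[OF T] by (simp add: T.diff surj_f_inv_f)
    then show ?thesis by (simp add: e_def normT indicator_def)
  qed
  have e_T0: "e (T y) = e y" for y by (simp add: e_def normT indicator_def)
  define v where "v = (\<integral>\<^sup>+y. e y \<partial>(lborel :: 'a measure))"
  have v: "v = emeasure lborel (ball (0::'a) 1)" by (simp add: v_def e_def)
  have v_fin: "v \<noteq> \<infinity>" "v \<noteq> 0"
    unfolding v using emeasure_lborel_ball_finite[of "0::'a" 1] content_ball_pos[of 1 "0::'a"]
    by (auto simp: measure_def)
  have *: "v * emeasure lborel A = v * emeasure \<nu> A"
  proof -
    have "v * emeasure lborel A = (\<integral>\<^sup>+y. (\<integral>\<^sup>+x. indicator A x * e (T y) \<partial>lborel) \<partial>lborel)"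
      by (simp add: nn_integral_multc nn_integral_cmult e_T0 v_def mult.commute)
    also have "\<dots> = (\<integral>\<^sup>+y. (\<integral>\<^sup>+x. indicator A (T y + x) * e (T y) \<partial>lborel) \<partial>lborel)"
      by (intro nn_integral_cong transl[symmetric]) measurable
    also have "\<dots> = (\<integral>\<^sup>+x. (\<integral>\<^sup>+y. indicator A (T y + x) * e (T y) \<partial>lborel) \<partial>lborel)"
      by (rule lborel_pair.Fubini') measurable
    also have "\<dots> = (\<integral>\<^sup>+x. (\<integral>\<^sup>+y. indicator A (T y) * e (T y - x) \<partial>lborel) \<partial>lborel)"
    proof (rule nn_integral_cong)
      fix x :: 'a
      have "(\<integral>\<^sup>+y. indicator A (T y) * e (T y - x) \<partial>lborel)
          = (\<integral>\<^sup>+y. indicator A (T (inv T x + y)) * e (T (inv T x + y) - x) \<partial>lborel)"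
        by (rule transl[symmetric]) measurable
      then show "(\<integral>\<^sup>+y. indicator A (T y + x) * e (T y) \<partial>lborel)
          = (\<integral>\<^sup>+y. indicator A (T y) * e (T y - x) \<partial>lborel)"
        using orthogonal_transformation_surj[OF T] by (simp add: T.add surj_f_inv_f add.commute)
    qed
    also have "\<dots> = (\<integral>\<^sup>+y. (\<integral>\<^sup>+x. indicator A (T y) * e (T y - x) \<partial>lborel) \<partial>lborel)"
      by (rule lborel_pair.Fubini'[symmetric]) measurable
    also have "\<dots> = (\<integral>\<^sup>+y. indicator A (T y) * v \<partial>lborel)"
    proof (rule nn_integral_cong)
      fix y :: 'a
      have "(\<integral>\<^sup>+x. e (T y - x) \<partial>lborel) = (\<integral>\<^sup>+x. e (T y - (T y + x)) \<partial>lborel)"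
        by (rule transl[symmetric]) measurable
      also have "\<dots> = v" by (simp add: v_def e_def indicator_def)
      finally show "(\<integral>\<^sup>+x. indicator A (T y) * e (T y - x) \<partial>lborel) = indicator A (T y) * v"
        by (simp add: nn_integral_cmult)
    qed
    also have "\<dots> = v * emeasure \<nu> A"
      using nn_\<nu>[of "indicator A"] by (simp add: nn_integral_cmult mult.commute)
    finally show ?thesis .
  qed
  show "emeasure (distr lborel borel T) A = emeasure lborel A"
    using * v_fin by (auto simp: ennreal_mult_cancel_left \<nu>_def)
qed

lemma integral_orthogonal:
  fixes T :: "'a::euclidean_space \<Rightarrow> 'a" and u :: "'a \<Rightarrow> 'b::{banach, second_countable_topology}"
  assumes T: "orthogonal_transformation T" and u [measurable]: "u \<in> borel_measurable borel"
  shows "(LINT x|lborel. u (T x)) = (LINT x|lborel. u x)"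
proof -
  have "continuous_on UNIV T"
    using orthogonal_transformation_linear[OF T] by (simp add: linear_continuous_on linear_conv_bounded_linear)
  then have [measurable]: "T \<in> borel_measurable borel" by (rule borel_measurable_continuous_onI)
  show ?thesis
    by (subst (2) distr_orthogonal_lborel[OF T, symmetric]) (simp add: integral_distr)
qed

text \<open>
  Polar form of the surface integral, which reduces its rotation invariance to that of
  Lebesgue measure.
\<close>

lemma integral_surface_measure:
  fixes F :: "real^'n \<Rightarrow> complex"
  assumes F: "F \<in> borel_measurable (restrict_space borel (sphere 0 1))"
  shows "(LINT \<omega>|surface_measure. F \<omega>) =
    of_nat CARD('n) * (LINT x|lborel. indicator (ball 0 1 - {0}) x *\<^sub>R F (x /\<^sub>R norm x))"
proof -
  let ?B = "ball 0 1 - {0} :: (real^'n) set" and ?S = "restrict_space borel (sphere 0 1 :: (real^'n) set)"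
  let ?D = "distr (restrict_space lborel ?B) ?S (\<lambda>x. x /\<^sub>R norm x)"
  have meas: "(\<lambda>x. x /\<^sub>R norm x) \<in> restrict_space lborel ?B \<rightarrow>\<^sub>M ?S"
    by (rule measurable_restrict_space2)
      (auto simp: space_restrict_space intro!: measurable_restrict_space1)
  have sc: "(surface_measure :: (real^'n) measure) = density ?D (\<lambda>_. ennreal (real CARD('n)))"
    unfolding surface_measure_def
    by (rule measure_eqI) (auto simp: emeasure_density nn_integral_cmult ennreal_of_nat_eq_real_of_nat)
  have "(LINT \<omega>|surface_measure. F \<omega>) = (LINT \<omega>|?D. real CARD('n) *\<^sub>R F \<omega>)"
    unfolding sc using F by (subst integral_density) auto
  also have "\<dots> = (LINT x|restrict_space lborel ?B. real CARD('n) *\<^sub>R F (x /\<^sub>R norm x))"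
    using F meas by (subst integral_distr) auto
  also have "\<dots> = (LINT x|lborel. indicator ?B x *\<^sub>R (real CARD('n) *\<^sub>R F (x /\<^sub>R norm x)))"
    by (subst integral_restrict_space) auto
  also have "\<dots> = of_nat CARD('n) * (LINT x|lborel. indicator ?B x *\<^sub>R F (x /\<^sub>R norm x))"
    by (simp add: scaleR_conv_of_real mult.left_commute)
  finally show ?thesis .
qed


lemma emeasure_punctured_ball:
  "emeasure lborel (ball 0 1 - {0 :: real^'n}) = ennreal (measure lborel (ball (0 :: real^'n) 1))"
  using emeasure_lborel_ball_finite[of "0 :: real^'n" 1]
  by (subst emeasure_Diff_null_set) (auto simp: countable_imp_null_set_lborel emeasure_eq_ennreal_measure)

lemma emeasure_surface_measure_sphere:
  "emeasure surface_measure (sphere 0 1 :: (real^'n) set)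
     = ennreal (real CARD('n) * measure lborel (ball (0 :: real^'n) 1))"
proof -
  have "{r *\<^sub>R \<omega> | r \<omega>. 0 < r \<and> r < 1 \<and> \<omega> \<in> sphere 0 1} = ball 0 1 - {0 :: real^'n}" (is "?L = ?R")
  proof
    show "?L \<subseteq> ?R" by (auto simp: dist_norm)
    show "?R \<subseteq> ?L"
    proof
      fix x :: "real^'n" assume x: "x \<in> ?R"
      then have "x = norm x *\<^sub>R (x /\<^sub>R norm x)" "0 < norm x" "norm x < 1" "x /\<^sub>R norm x \<in> sphere 0 1"
        by auto
      then show "x \<in> ?L" by blast
    qed
  qed
  then show ?thesis
    by (simp add: emeasure_surface_measure emeasure_punctured_ball ennreal_mult' ennreal_of_nat_eq_real_of_nat)
qed

lemma finite_measure_surface_measure: "finite_measure (surface_measure :: (real^'n) measure)"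
  by (rule finite_measureI) (simp add: space_surface_measure emeasure_surface_measure_sphere)

lemma measure_sphere_pos: "measure surface_measure (sphere 0 1 :: (real^'n) set) > 0"
  by (simp add: measure_def[of surface_measure] emeasure_surface_measure_sphere content_ball_pos)

lemma measurable_surface_measure:
  fixes F :: "real^'n \<Rightarrow> complex"
  assumes "continuous_on UNIV F"
  shows "F \<in> borel_measurable surface_measure"
proof -
  have "F \<in> borel_measurable (restrict_space borel (sphere 0 1))"
    using assms by (intro borel_measurable_continuous_on_restrict continuous_on_subset[OF assms]) auto
  then show ?thesis by (simp add: surface_measure_def measurable_def space_scale_measure)
qed

lemma integrable_surface_measure:
  fixes F :: "real^'n \<Rightarrow> complex"
  assumes "continuous_on UNIV F"
  shows "integrable surface_measure F"
proof -
  have "compact (F ` sphere 0 1)"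
    using assms by (intro compact_continuous_image continuous_on_subset[OF assms]) auto
  then obtain B where "\<And>\<omega>. \<omega> \<in> sphere 0 1 \<Longrightarrow> norm (F \<omega>) \<le> B"
    using compact_imp_bounded by (force simp: bounded_iff)
  then show ?thesis
    using measurable_surface_measure[OF assms]
    by (intro finite_measure.integrable_const_bound[OF finite_measure_surface_measure, of _ B] AE_I2)
       (auto simp: space_surface_measure)
qed

lemma integral_surface_measure_orthogonal:
  fixes F :: "real^'n \<Rightarrow> complex" and T :: "real^'n \<Rightarrow> real^'n"
  assumes F: "continuous_on UNIV F" and T: "orthogonal_transformation T"
  shows "(LINT \<omega>|surface_measure. F (T \<omega>)) = (LINT \<omega>|surface_measure. F \<omega>)"
proof -
  let ?u = "\<lambda>x. indicator (ball 0 1 - {0}) x *\<^sub>R F (x /\<^sub>R norm x)"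
  interpret T: linear T using T by (rule orthogonal_transformation_linear)
  have normT: "norm (T x) = norm x" for x using T by (rule orthogonal_transformation_norm)
  have contT: "continuous_on UNIV T"
    using T.linear_axioms by (simp add: linear_continuous_on linear_conv_bounded_linear)
  have FT: "continuous_on UNIV (\<lambda>x. F (T x))"
    by (rule continuous_on_compose2[OF F contT]) simp
  have meas: "G \<in> borel_measurable (restrict_space borel (sphere 0 1))" if "continuous_on UNIV G"
    for G :: "real^'n \<Rightarrow> complex"
    by (intro borel_measurable_continuous_on_restrict continuous_on_subset[OF that]) auto
  have F_meas [measurable]: "F \<in> borel_measurable borel"
    by (rule borel_measurable_continuous_onI[OF F])
  have "T x = 0 \<longleftrightarrow> x = 0" for x using normT[of x] by (metis norm_eq_zero)
  then have "indicator (ball 0 1 - {0}) (T x) = (indicator (ball 0 1 - {0}) x :: real)" for x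
    by (simp add: indicator_def normT)
  then have "(LINT x|lborel. indicator (ball 0 1 - {0}) x *\<^sub>R F (T (x /\<^sub>R norm x))) = (LINT x|lborel. ?u (T x))"
    by (simp add: normT T.scale)
  also have "\<dots> = (LINT x|lborel. ?u x)"
  proof (rule integral_orthogonal[OF T])
    have "(\<lambda>x. F (x /\<^sub>R norm x)) \<in> borel_measurable borel" by measurable
    moreover have "(indicator (ball 0 1 - {0}) :: real^'n \<Rightarrow> real) \<in> borel_measurable borel"
      by (intro borel_measurable_indicator) auto
    ultimately show "?u \<in> borel_measurable borel" by measurable
  qed
  finally show ?thesis by (simp add: integral_surface_measure meas F FT)
qed

section \<open>Spherical means\<close>

lemma continuous_on_radial_slice:
  fixes \<phi> :: "real^'n \<Rightarrow> complex"
  shows "continuous_on UNIV \<phi> \<Longrightarrow> continuous_on UNIV (\<lambda>\<omega>. \<phi> (r *\<^sub>R \<omega>))"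
  by (rule continuous_on_compose2) (auto intro!: continuous_intros)

lemma spherical_mean_orthogonal:
  fixes \<phi> :: "real^'n \<Rightarrow> complex" and T :: "real^'n \<Rightarrow> real^'n"
  assumes \<phi>: "continuous_on UNIV \<phi>" and T: "orthogonal_transformation T"
  shows "spherical_mean (\<lambda>x. \<phi> (T x)) = spherical_mean \<phi>"
proof -
  have "T (r *\<^sub>R \<omega>) = r *\<^sub>R T \<omega>" for r \<omega>
    using T by (rule orthogonal_transformation_scaleR)
  then show ?thesis
    using integral_surface_measure_orthogonal[OF continuous_on_radial_slice[OF \<phi>] T]
    by (simp add: spherical_mean_def)
qed

lemma spherical_mean_midpoint:
  fixes \<phi> \<psi> :: "real^'n \<Rightarrow> complex"
  assumes "continuous_on UNIV \<phi>" "continuous_on UNIV \<psi>" "spherical_mean \<phi> = spherical_mean \<psi>"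
  shows "spherical_mean (\<lambda>x. (\<phi> x + \<psi> x) / 2) = spherical_mean \<psi>"
proof
  fix x :: "real^'n"
  have "integrable surface_measure (\<lambda>\<omega>. \<phi> (norm x *\<^sub>R \<omega>))" "integrable surface_measure (\<lambda>\<omega>. \<psi> (norm x *\<^sub>R \<omega>))"
    using assms by (auto intro!: integrable_surface_measure continuous_on_radial_slice)
  then have "spherical_mean (\<lambda>x. (\<phi> x + \<psi> x) / 2) x = (spherical_mean \<phi> x + spherical_mean \<psi> x) / 2"
    by (simp add: spherical_mean_def scaleR_conv_of_real add_divide_distrib distrib_left mult.commute)
  then show "spherical_mean (\<lambda>x. (\<phi> x + \<psi> x) / 2) x = spherical_mean \<psi> x"
    by (simp add: assms(3))
qed

lemma spherical_mean_radial:
  fixes \<phi> :: "real^'n \<Rightarrow> complex"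
  assumes "\<And>x y. norm x = norm y \<Longrightarrow> \<phi> x = \<phi> y"
  shows "spherical_mean \<phi> = \<phi>"
proof
  fix x :: "real^'n"
  have "(LINT \<omega>|surface_measure. \<phi> (norm x *\<^sub>R \<omega>)) = (LINT \<omega>|(surface_measure :: (real^'n) measure). \<phi> x)"
    by (intro Bochner_Integration.integral_cong assms) (auto simp: space_surface_measure)
  then show "spherical_mean \<phi> x = \<phi> x"
    using measure_sphere_pos[where 'n='n] by (simp add: spherical_mean_def space_surface_measure)
qed

text \<open>
  Dominated convergence on the sphere of radius \<open>norm x\<close>.
\<close>

lemma spherical_mean_tendsto:
  fixes g :: "nat \<Rightarrow> real^'n \<Rightarrow> complex"
  assumes g: "\<And>k. continuous_on UNIV (g k)" and G: "continuous_on UNIV G"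
    and lim: "\<And>y. (\<lambda>k. g k y) \<longlonglongrightarrow> G y"
    and bound: "\<And>k y. norm y \<le> norm x \<Longrightarrow> cmod (g k y) \<le> B"
  shows "(\<lambda>k. spherical_mean (g k) x) \<longlonglongrightarrow> spherical_mean G x"
  unfolding spherical_mean_def
proof (intro tendsto_intros, rule integral_dominated_convergence[where w="\<lambda>_. B"])
  show "integrable surface_measure (\<lambda>_. B)"
    using finite_measure.integrable_const[OF finite_measure_surface_measure] .
qed (use assms in \<open>auto intro!: measurable_surface_measure continuous_on_radial_slice AE_I2
        simp: space_surface_measure\<close>)

section \<open>Iterated partial derivatives\<close>

lemma iterated_partial_Nil [simp]: "iterated_partial [] f = f"
  by (simp add: iterated_partial_def)

lemma iterated_partial_Cons [simp]:
  "iterated_partial (i # js) f = partial_deriv i (iterated_partial js f)"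
  by (simp add: iterated_partial_def)

lemma iterated_partial_append:
  "iterated_partial (js @ ks) f = iterated_partial js (iterated_partial ks f)"
  by (simp add: iterated_partial_def)

lemma smooth_iterated_partial: "smooth f \<Longrightarrow> smooth (iterated_partial js f)"
  by (auto simp only: smooth_def iterated_partial_append[symmetric])

lemma smooth_partial_deriv: "smooth f \<Longrightarrow> smooth (partial_deriv i f)"
  using smooth_iterated_partial[of f "[i]"] by simp

lemma smooth_imp_differentiable: "smooth f \<Longrightarrow> f differentiable (at x)"
  unfolding smooth_def by (drule spec[of _ "[]"]) simp

lemma smooth_imp_continuous_on: "smooth f \<Longrightarrow> continuous_on S f"
  by (intro continuous_at_imp_continuous_on ballI differentiable_imp_continuous_within smooth_imp_differentiable)

lemma has_vector_derivative_line:
  "((\<lambda>t. x + t *\<^sub>R v) has_vector_derivative v) (at t within S)"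
  unfolding has_vector_derivative_def by (rule derivative_eq_intros refl | simp)+

lemma has_vector_derivative_along_axis:
  assumes "f differentiable (at (x + t *\<^sub>R axis i 1))"
  shows "((\<lambda>t. f (x + t *\<^sub>R axis i 1)) has_vector_derivative partial_deriv i f (x + t *\<^sub>R axis i 1)) (at t)"
proof -
  have "(f \<circ> (\<lambda>s. (x + t *\<^sub>R axis i 1) + s *\<^sub>R axis i 1)) differentiable (at (0::real))"
    using assms by (intro differentiable_chain_at derivative_intros) auto
  then have "((\<lambda>s. f ((x + t *\<^sub>R axis i 1) + s *\<^sub>R axis i 1)) has_vector_derivative
      partial_deriv i f (x + t *\<^sub>R axis i 1)) (at 0)"
    unfolding o_def vector_derivative_works partial_deriv_def .
  then have "((\<lambda>s. f ((x + t *\<^sub>R axis i 1) + s *\<^sub>R axis i 1)) \<circ> (\<lambda>s. s - t) has_vector_derivative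
      1 *\<^sub>R partial_deriv i f (x + t *\<^sub>R axis i 1)) (at t)"
    using has_vector_derivative_line[of "-t" 1 t]
    by (intro vector_diff_chain_at) simp_all
  moreover have "(\<lambda>s. f ((x + t *\<^sub>R axis i 1) + s *\<^sub>R axis i 1)) \<circ> (\<lambda>s. s - t) = (\<lambda>s. f (x + s *\<^sub>R axis i 1))"
    by (simp add: fun_eq_iff scaleR_left_diff_distrib)
  ultimately show ?thesis by (simp only: scaleR_one)
qed

lemma partial_deriv_eq_has_derivative:
  fixes f :: "real^'n \<Rightarrow> complex"
  assumes D: "(f has_derivative D) (at x)"
  shows "partial_deriv i f x = D (axis i 1)"
proof -
  have "((\<lambda>t. x + t *\<^sub>R axis i 1) has_vector_derivative axis i 1) (at (0::real))"
    by (rule has_vector_derivative_line)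
  from vector_derivative_diff_chain_within[OF this, of f D] D
  have "((\<lambda>t. f (x + t *\<^sub>R axis i 1)) has_vector_derivative D (axis i 1)) (at 0)"
    by (simp add: o_def has_derivative_at_withinI)
  then show ?thesis by (simp add: partial_deriv_def vector_derivative_at)
qed

lemma has_derivative_partial_derivs:
  fixes f :: "real^'n \<Rightarrow> complex"
  assumes "f differentiable (at x)"
  shows "(f has_derivative (\<lambda>h. \<Sum>i\<in>UNIV. (h $ i) *\<^sub>R partial_deriv i f x)) (at x)"
proof -
  obtain D where D: "(f has_derivative D) (at x)" using assms by (auto simp: differentiable_def)
  interpret D: linear D using D by (rule has_derivative_linear)
  have "D h = (\<Sum>i\<in>UNIV. (h $ i) *\<^sub>R partial_deriv i f x)" for h
  proof -
    have "D (\<Sum>i\<in>UNIV. (h $ i) *\<^sub>R axis i 1) = (\<Sum>i\<in>UNIV. (h $ i) *\<^sub>R partial_deriv i f x)"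
      by (simp only: D.sum D.scale partial_deriv_eq_has_derivative[OF D])
    moreover have "(\<Sum>i\<in>UNIV. (h $ i) *\<^sub>R axis i 1) = h"
      using basis_expansion[of h] by (simp only: scalar_mult_eq_scaleR)
    ultimately show ?thesis by (simp only:)
  qed
  then have "D = (\<lambda>h. \<Sum>i\<in>UNIV. (h $ i) *\<^sub>R partial_deriv i f x)" by (rule ext)
  with D show ?thesis by (simp only:)
qed

text \<open>
  The increment of \<open>partial_deriv j f\<close> along the \<open>i\<close>-th axis is obtained by differentiating
  \<open>f(x + s e\<^sub>i) - f(x) = \<integral>\<^sub>0\<^sup>s \<partial>\<^sub>i f(x + \<sigma> e\<^sub>i) d\<sigma>\<close> in direction \<open>j\<close> under the integral sign.
  Differentiating the result at \<open>s = 0\<close> gives the symmetry.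
\<close>

lemma partial_deriv_commute:
  fixes f :: "real^'n \<Rightarrow> complex"
  assumes f: "smooth f"
  shows "partial_deriv i (partial_deriv j f) = partial_deriv j (partial_deriv i f)"
proof
  fix x :: "real^'n"
  let ?e = "axis i 1 :: real^'n" and ?d = "axis j 1 :: real^'n"
  let ?fi = "partial_deriv i f" and ?fj = "partial_deriv j f" and ?h = "partial_deriv j (partial_deriv i f)"
  have fi: "smooth ?fi" and h: "smooth ?h" and fj: "smooth ?fj"
    by (intro smooth_partial_deriv f)+
  have deriv: "((\<lambda>t. g (z + t *\<^sub>R axis k 1)) has_vector_derivative partial_deriv k g (z + t *\<^sub>R axis k 1)) (at t)"
    if "smooth g" for g :: "real^'n \<Rightarrow> complex" and z t k
    by (rule has_vector_derivative_along_axis[OF smooth_imp_differentiable[OF that]])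
  have cont: "continuous_on S (\<lambda>z. g (k z))" if "smooth g" "continuous_on S k"
    for g :: "real^'n \<Rightarrow> complex" and k :: "'b::topological_space \<Rightarrow> real^'n" and S
    using continuous_on_compose2[OF smooth_imp_continuous_on[OF that(1), of UNIV] that(2)] by simp
  have increment: "?fj (x + s *\<^sub>R ?e) - ?fj x = integral {0..s} (\<lambda>\<sigma>. ?h (x + \<sigma> *\<^sub>R ?e))" if s: "s \<ge> 0" for s
  proof -
    have ftc: "f (x + \<tau> *\<^sub>R ?d + s *\<^sub>R ?e) - f (x + \<tau> *\<^sub>R ?d)
        = integral (cbox 0 s) (\<lambda>\<sigma>. ?fi (x + \<tau> *\<^sub>R ?d + \<sigma> *\<^sub>R ?e))" for \<tau>
    proof -
      have "((\<lambda>\<sigma>. ?fi (x + \<tau> *\<^sub>R ?d + \<sigma> *\<^sub>R ?e)) has_integral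
        f (x + \<tau> *\<^sub>R ?d + s *\<^sub>R ?e) - f (x + \<tau> *\<^sub>R ?d + 0 *\<^sub>R ?e)) {0..s}"
        by (rule fundamental_theorem_of_calculus[OF s])
           (rule has_vector_derivative_at_within, rule deriv[OF f])
      then show ?thesis by (simp add: integral_unique)
    qed
    have "((\<lambda>\<tau>. integral (cbox 0 s) (\<lambda>\<sigma>. ?fi (x + \<tau> *\<^sub>R ?d + \<sigma> *\<^sub>R ?e))) has_vector_derivative
        integral (cbox 0 s) (\<lambda>\<sigma>. ?h (x + 0 *\<^sub>R ?d + \<sigma> *\<^sub>R ?e))) (at 0 within UNIV)"
    proof (rule leibniz_rule_vector_derivative)
      show "((\<lambda>\<tau>. ?fi (x + \<tau> *\<^sub>R ?d + \<sigma> *\<^sub>R ?e)) has_vector_derivative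
          ?h (x + \<tau> *\<^sub>R ?d + \<sigma> *\<^sub>R ?e)) (at \<tau> within UNIV)" for \<tau> \<sigma>
        using deriv[OF fi, of "x + \<sigma> *\<^sub>R ?e" j \<tau>] by (simp add: add.assoc add.commute[of "_ *\<^sub>R ?e"])
      show "continuous_on (UNIV \<times> cbox 0 s) (\<lambda>(\<tau>, \<sigma>). ?h (x + \<tau> *\<^sub>R ?d + \<sigma> *\<^sub>R ?e))"
        unfolding split_beta by (rule cont[OF h]) (intro continuous_intros)
      show "(\<lambda>\<sigma>. ?fi (x + \<tau> *\<^sub>R ?d + \<sigma> *\<^sub>R ?e)) integrable_on cbox 0 s" for \<tau>
        by (rule integrable_continuous, rule cont[OF fi]) (intro continuous_intros)
    qed auto
    moreover have "((\<lambda>\<tau>. f (x + \<tau> *\<^sub>R ?d + s *\<^sub>R ?e) - f (x + \<tau> *\<^sub>R ?d)) has_vector_derivative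
        ?fj (x + s *\<^sub>R ?e) - ?fj x) (at 0)"
      using has_vector_derivative_diff[OF deriv[OF f, of "x + s *\<^sub>R ?e" j 0] deriv[OF f, of x j 0]]
      by (simp add: add.assoc add.commute[of "_ *\<^sub>R ?e"])
    ultimately show ?thesis
      unfolding ftc using vector_derivative_unique_at by fastforce
  qed
  have "((\<lambda>s. integral {0..s} (\<lambda>\<sigma>. ?h (x + \<sigma> *\<^sub>R ?e))) has_vector_derivative ?h (x + 0 *\<^sub>R ?e)) (at 0 within {0..1})"
    by (rule integral_has_vector_derivative, rule cont[OF h]) (intro continuous_intros, simp)
  moreover have "((\<lambda>s. ?fj (x + s *\<^sub>R ?e) - ?fj x) has_vector_derivative partial_deriv i ?fj x) (at 0 within {0..1})"
    using has_vector_derivative_at_within[OF has_vector_derivative_diff[OF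
        deriv[OF fj, of x i 0] has_vector_derivative_const[of "?fj x"]]]
    by simp
  then have "((\<lambda>s. integral {0..s} (\<lambda>\<sigma>. ?h (x + \<sigma> *\<^sub>R ?e))) has_vector_derivative partial_deriv i ?fj x) (at 0 within {0..1})"
    by (rule has_vector_derivative_transform[rotated 2]) (auto simp: increment)
  ultimately show "partial_deriv i ?fj x = ?h x"
    by (intro vector_derivative_unique_within_closed_interval[of 0 1 0]) auto
qed

lemma iterated_partial_mset:
  assumes f: "smooth f" and "mset js = mset ks"
  shows "iterated_partial js f = iterated_partial ks f"
  using assms(2)
proof (induction js arbitrary: ks)
  case Nil
  then show ?case by simp
next
  case (Cons i js)
  then have "i \<in> set ks" by (metis list.set_intros(1) mset_eq_setD)
  then obtain as bs where ks: "ks = as @ i # bs" by (auto simp: in_set_conv_decomp)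
  have "iterated_partial (as @ i # bs) f = iterated_partial (i # as @ bs) f"
    by (induction as) (simp_all add: partial_deriv_commute smooth_iterated_partial[OF f])
  moreover have "iterated_partial js f = iterated_partial (as @ bs) f"
    using Cons ks by simp
  ultimately show ?case by (simp add: ks)
qed

text \<open>
  These two lemmas make bounds on all \<^const>\<open>multi_deriv\<close> and bounds on all
  \<^const>\<open>iterated_partial\<close> interchangeable. The latter are needed because a linear change of
  variables mixes the coordinates in every possible order.
\<close>

lemma multi_deriv_eq_iterated_partial:
  fixes \<alpha> :: "'n::finite \<Rightarrow> nat"
  obtains js where "length js = multi_order \<alpha>" "\<And>f. multi_deriv \<alpha> f = iterated_partial js f"
proof -
  let ?js = "SOME js. \<forall>i. count_list js i = \<alpha> i"
  have "\<forall>i. count_list ?js i = \<alpha> i" using someI_ex[OF multi_index_list_exists[of \<alpha>]] .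
  then have "length ?js = multi_order \<alpha>" by (simp flip: sum_count_set[of ?js UNIV])
  then show thesis using that[of ?js] by (simp add: multi_deriv_def)
qed

lemma iterated_partial_eq_multi_deriv:
  fixes f :: "real^'n \<Rightarrow> complex"
  assumes "smooth f"
  shows "iterated_partial js f = multi_deriv (count_list js) f" "multi_order (count_list js) = length js"
proof -
  have "\<forall>i. count_list (SOME ks. \<forall>i. count_list ks i = count_list js i) i = count_list js i"
    using someI_ex[OF multi_index_list_exists[of "count_list js"]] .
  then have "mset (SOME ks. \<forall>i. count_list ks i = count_list js i) = mset js"
    by (intro multiset_eqI) (simp add: count_mset)
  from iterated_partial_mset[OF assms this]
  show "iterated_partial js f = multi_deriv (count_list js) f" by (simp add: multi_deriv_def)
  show "multi_order (count_list js) = length js" by (simp add: sum_count_set)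
qed

section \<open>Linear changes of variables\<close>

text \<open>
  By the chain rule every derivative of \<open>f \<circ> T\<close> in an axis direction is a combination of all
  partial derivatives of \<open>f\<close>, with entries of \<open>T\<close> as coefficients. Only their size matters later,
  so the coefficients are left existentially quantified.
\<close>

lemma iterated_partial_matrix_vector_mult:
  fixes f :: "real^'n \<Rightarrow> complex" and T :: "real^'n^'n"
  assumes f: "smooth f" and T: "\<And>i j. \<bar>T $ i $ j\<bar> \<le> 1"
  shows "\<exists>c. (\<forall>ks. \<bar>c ks\<bar> \<le> 1) \<and> iterated_partial js (\<lambda>x. f (T *v x)) =
    (\<lambda>x. \<Sum>ks | length ks = length js. c ks *\<^sub>R iterated_partial ks f (T *v x))"
proof (induction js)
  case Nil
  show ?case by (rule exI[of _ "\<lambda>_. 1"]) simp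
next
  case (Cons i js)
  then obtain c where c: "\<And>ks. \<bar>c ks\<bar> \<le> 1" and
    eq: "iterated_partial js (\<lambda>x. f (T *v x)) =
      (\<lambda>x. \<Sum>ks | length ks = length js. c ks *\<^sub>R iterated_partial ks f (T *v x))" by auto
  define c' where "c' ks = T $ (hd ks) $ i * c (tl ks)" for ks
  have "partial_deriv i (\<lambda>x. \<Sum>ks | length ks = length js. c ks *\<^sub>R iterated_partial ks f (T *v x)) x
      = (\<Sum>ks | length ks = Suc (length js). c' ks *\<^sub>R iterated_partial ks f (T *v x))" for x
  proof -
    have "((\<lambda>t. \<Sum>ks | length ks = length js. c ks *\<^sub>R iterated_partial ks f (T *v (x + t *\<^sub>R axis i 1)))
      has_vector_derivative (\<Sum>ks | length ks = length js. c ks *\<^sub>R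
        (\<Sum>j\<in>UNIV. (T $ j $ i) *\<^sub>R partial_deriv j (iterated_partial ks f) (T *v x)))) (at 0)"
    proof (intro has_vector_derivative_sum bounded_linear.has_vector_derivative[OF bounded_linear_scaleR_right])
      fix ks
      let ?g = "iterated_partial ks f"
      have D: "(?g has_derivative (\<lambda>h. \<Sum>j\<in>UNIV. (h $ j) *\<^sub>R partial_deriv j ?g (T *v x)))
          (at (T *v x + 0 *\<^sub>R column i T))"
        using has_derivative_partial_derivs[OF smooth_imp_differentiable[OF smooth_iterated_partial[OF f]]]
        by simp
      have "((\<lambda>t. T *v x + t *\<^sub>R column i T) has_vector_derivative column i T) (at (0::real))"
        by (rule has_vector_derivative_line)
      from vector_derivative_diff_chain_within[OF this has_derivative_at_withinI[OF D]]
      have "((\<lambda>t. ?g (T *v x + t *\<^sub>R column i T)) has_vector_derivative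
          (\<Sum>j\<in>UNIV. (T $ j $ i) *\<^sub>R partial_deriv j ?g (T *v x))) (at 0)"
        by (simp add: o_def column_def)
      moreover have "T *v (x + t *\<^sub>R axis i 1) = T *v x + t *\<^sub>R column i T" for t
        by (simp add: linear_add[OF matrix_vector_mul_linear] linear_scale[OF matrix_vector_mul_linear]
            matrix_vector_mult_basis)
      ultimately show "((\<lambda>t. ?g (T *v (x + t *\<^sub>R axis i 1))) has_vector_derivative
          (\<Sum>j\<in>UNIV. (T $ j $ i) *\<^sub>R partial_deriv j ?g (T *v x))) (at 0)"
        by simp
    qed
    then have "partial_deriv i (\<lambda>x. \<Sum>ks | length ks = length js. c ks *\<^sub>R iterated_partial ks f (T *v x)) x
      = (\<Sum>ks | length ks = length js. \<Sum>j\<in>UNIV. c' (j # ks) *\<^sub>R iterated_partial (j # ks) f (T *v x))"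
      by (subst partial_deriv_def) (simp add: vector_derivative_at scaleR_sum_right c'_def mult.commute)
    also have "\<dots> = (\<Sum>(ks, j)\<in>{ks. length ks = length js} \<times> UNIV. c' (j # ks) *\<^sub>R iterated_partial (j # ks) f (T *v x))"
      by (simp add: sum.cartesian_product)
    also have "\<dots> = (\<Sum>ks | length ks = Suc (length js). c' ks *\<^sub>R iterated_partial ks f (T *v x))"
      by (rule sum.reindex_bij_witness[where i="\<lambda>ks. (tl ks, hd ks)" and j="\<lambda>(ks, j). j # ks"])
         (auto simp: length_Suc_conv)
    finally show ?thesis .
  qed
  moreover have "\<bar>c' ks\<bar> \<le> 1" for ks
    unfolding c'_def abs_mult using mult_mono[OF T c] by simp
  ultimately show ?case by (intro exI[of _ c']) (simp add: eq fun_eq_iff)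
qed

lemma smooth_matrix_vector_mult:
  fixes f :: "real^'n \<Rightarrow> complex" and T :: "real^'n^'n"
  assumes f: "smooth f" and T: "\<And>i j. \<bar>T $ i $ j\<bar> \<le> 1"
  shows "smooth (\<lambda>x. f (T *v x))"
  unfolding smooth_def
proof (intro allI)
  fix js :: "'n list" and x :: "real^'n"
  obtain c where eq: "iterated_partial js (\<lambda>x. f (T *v x)) =
      (\<lambda>x. \<Sum>ks | length ks = length js. c ks *\<^sub>R iterated_partial ks f (T *v x))"
    using iterated_partial_matrix_vector_mult[OF assms] by blast
  have fin: "finite {ks :: 'n list. length ks = length js}"
    using finite_lists_length_eq[of "UNIV :: 'n set"] by simp
  have lin: "(\<lambda>x. T *v x) differentiable (at x)"
    by (intro linear_imp_differentiable matrix_vector_mul_linear)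
  have "(\<lambda>x. iterated_partial ks f (T *v x)) differentiable (at x)" for ks
    using differentiable_chain_at[OF lin smooth_imp_differentiable[OF smooth_iterated_partial[OF f]]]
    by (simp add: o_def)
  then show "iterated_partial js (\<lambda>x. f (T *v x)) differentiable (at x)"
    unfolding eq using fin by (intro differentiable_sum differentiable_scaleR) auto
qed

lemma norm_iterated_partial_matrix_vector_mult_le:
  fixes f :: "real^'n \<Rightarrow> complex" and T :: "real^'n^'n"
  assumes f: "smooth f" and T: "\<And>i j. \<bar>T $ i $ j\<bar> \<le> 1"
    and b: "\<And>ks. length ks = length js \<Longrightarrow> cmod (iterated_partial ks f (T *v x)) \<le> b"
  shows "cmod (iterated_partial js (\<lambda>x. f (T *v x)) x) \<le> real CARD('n) ^ length js * b"
proof -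
  obtain c where c: "\<And>ks. \<bar>c ks\<bar> \<le> 1" and eq: "iterated_partial js (\<lambda>x. f (T *v x)) =
      (\<lambda>x. \<Sum>ks | length ks = length js. c ks *\<^sub>R iterated_partial ks f (T *v x))"
    using iterated_partial_matrix_vector_mult[OF assms(1,2)] by blast
  have "cmod (iterated_partial js (\<lambda>x. f (T *v x)) x)
      \<le> (\<Sum>ks | length ks = length js. \<bar>c ks\<bar> * cmod (iterated_partial ks f (T *v x)))"
    unfolding eq using norm_sum[of "\<lambda>ks. c ks *\<^sub>R iterated_partial ks f (T *v x)"] by simp
  also have "\<dots> \<le> (\<Sum>ks :: 'n list | length ks = length js. 1 * b)"
    using c b by (intro sum_mono mult_mono) auto
  also have "\<dots> = real CARD('n) ^ length js * b"
    using card_lists_length_eq[of "UNIV :: 'n set" "length js"] by simp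
  finally show ?thesis .
qed

section \<open>Interpolation and smooth limits\<close>

lemma iterated_partial_diff:
  "smooth f \<Longrightarrow> smooth g \<Longrightarrow>
    iterated_partial js (\<lambda>x. f x - g x) = (\<lambda>x. iterated_partial js f x - iterated_partial js g x)"
  using iterated_partial_linear[of f g js 1 "-1"] by simp

lemma smooth_diff: "smooth f \<Longrightarrow> smooth g \<Longrightarrow> smooth (\<lambda>x. f x - g x)"
  using smooth_linear[of f g 1 "-1"] by simp

lemma norm_increment_le:
  fixes k :: "real \<Rightarrow> 'a::real_normed_vector"
  assumes "\<And>s. s \<in> {0..t} \<Longrightarrow> (k has_vector_derivative k' s) (at s)"
    and "\<And>s. s \<in> {0..t} \<Longrightarrow> norm (k' s) \<le> B" and "0 \<le> t"
  shows "norm (k t - k 0) \<le> B * t"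
proof -
  have "norm (k t - k 0) \<le> B * norm (t - 0)"
  proof (rule differentiable_bound[where S="{0..t}" and f'="\<lambda>s h. h *\<^sub>R k' s"])
    show "(k has_derivative (\<lambda>h. h *\<^sub>R k' s)) (at s within {0..t})" if "s \<in> {0..t}" for s
      using has_vector_derivative_at_within[OF assms(1)[OF that]] by (simp add: has_vector_derivative_def)
    show "onorm (\<lambda>h. h *\<^sub>R k' s) \<le> B" if "s \<in> {0..t}" for s
      using assms(2)[OF that] by (intro onorm_le) (simp add: mult.commute[of B] mult_left_mono)
  qed (use \<open>0 \<le> t\<close> in auto)
  then show ?thesis using \<open>0 \<le> t\<close> by simp
qed

text \<open>
  Taylor's formula with step \<open>t\<close>: a function that is small and has a bounded second
  derivative has a small first derivative, as is seen by choosing \<open>t\<close> small first.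
\<close>

lemma norm_partial_deriv_interpolation:
  fixes u :: "real^'n \<Rightarrow> complex"
  assumes u: "smooth u" and x: "x \<in> cball 0 R" and t: "0 < t" "t \<le> 1"
    and u_le: "\<And>y. y \<in> cball 0 (R + 1) \<Longrightarrow> cmod (u y) \<le> \<epsilon>"
    and u2_le: "\<And>y. y \<in> cball 0 (R + 1) \<Longrightarrow> cmod (partial_deriv i (partial_deriv i u) y) \<le> B"
  shows "cmod (partial_deriv i u x) \<le> 2 * \<epsilon> / t + B * t"
proof -
  let ?e = "axis i 1 :: real^'n"
  let ?u1 = "partial_deriv i u"
  have near: "x + s *\<^sub>R ?e \<in> cball 0 (R + 1)" if "s \<in> {0..t}" for s
    using x t that norm_triangle_ineq[of x "s *\<^sub>R ?e"] by auto
  have B: "0 \<le> B" using order_trans[OF norm_ge_zero u2_le[OF near[of 0]]] t by simp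
  have d: "((\<lambda>t. g (x + t *\<^sub>R ?e)) has_vector_derivative partial_deriv i g (x + s *\<^sub>R ?e)) (at s)"
    if "smooth g" for g s
    by (rule has_vector_derivative_along_axis[OF smooth_imp_differentiable[OF that]])
  have u1: "cmod (?u1 (x + s *\<^sub>R ?e) - ?u1 x) \<le> B * t" if s: "s \<in> {0..t}" for s
  proof -
    have "norm (?u1 (x + s *\<^sub>R ?e) - ?u1 (x + 0 *\<^sub>R ?e)) \<le> B * s"
      using s by (intro norm_increment_le[OF d[OF smooth_partial_deriv[OF u]]] u2_le near) auto
    also have "\<dots> \<le> B * t" using s B by (intro mult_left_mono) auto
    finally show ?thesis by simp
  qed
  have "norm ((u (x + t *\<^sub>R ?e) - t *\<^sub>R ?u1 x) - (u (x + 0 *\<^sub>R ?e) - 0 *\<^sub>R ?u1 x)) \<le> (B * t) * t"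
  proof (rule norm_increment_le)
    show "((\<lambda>t. u (x + t *\<^sub>R ?e) - t *\<^sub>R ?u1 x) has_vector_derivative ?u1 (x + s *\<^sub>R ?e) - ?u1 x) (at s)" for s
      using has_vector_derivative_diff[OF d[OF u] has_vector_derivative_line[of 0 "?u1 x"]] by simp
  qed (use u1 t in auto)
  then have "norm (u (x + t *\<^sub>R ?e) - u x - t *\<^sub>R ?u1 x) \<le> B * t * t" by (simp add: algebra_simps)
  moreover have "norm (u (x + t *\<^sub>R ?e) - u x) \<le> \<epsilon> + \<epsilon>"
    using u_le[OF near[of t]] u_le[OF near[of 0]] t norm_triangle_ineq4[of "u (x + t *\<^sub>R ?e)" "u x"] by simp
  ultimately have "norm (t *\<^sub>R ?u1 x) \<le> 2 * \<epsilon> + B * t * t"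
    using norm_triangle_ineq4[of "u (x + t *\<^sub>R ?e) - u x" "u (x + t *\<^sub>R ?e) - u x - t *\<^sub>R ?u1 x"] by simp
  then show ?thesis using t by (simp add: field_simps)
qed

lemma uniformly_Cauchy_on_partial_deriv:
  fixes g :: "nat \<Rightarrow> real^'n \<Rightarrow> complex"
  assumes g: "\<And>k. smooth (g k)"
    and bound: "\<And>k y. y \<in> cball 0 (R + 1) \<Longrightarrow> cmod (partial_deriv i (partial_deriv i (g k)) y) \<le> B"
    and Cauchy: "uniformly_Cauchy_on (cball 0 (R + 1)) g"
  shows "uniformly_Cauchy_on (cball 0 R) (\<lambda>k. partial_deriv i (g k))"
proof (rule uniformly_Cauchy_onI)
  fix e :: real assume e: "e > 0"
  define B' where "B' = max B 1"
  \<comment> \<open>With this \<open>t\<close>, both terms of the interpolation inequality for a difference are at most \<open>e / 4\<close>.\<close>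
  define t where "t = min 1 (e / (8 * B'))"
  have B': "B' > 0" "B \<le> B'" by (auto simp: B'_def)
  have t: "0 < t" "t \<le> 1" "2 * B' * t \<le> e / 4"
    using e B' by (auto simp: t_def min_def field_simps)
  have "e * t / 8 > 0" using e t by simp
  then obtain N where N: "\<And>y m n. y \<in> cball 0 (R + 1) \<Longrightarrow> N \<le> m \<Longrightarrow> N \<le> n \<Longrightarrow> dist (g m y) (g n y) < e * t / 8"
    using Cauchy unfolding uniformly_Cauchy_on_def by blast
  have "dist (partial_deriv i (g m) x) (partial_deriv i (g n) x) < e"
    if x: "x \<in> cball 0 R" and mn: "N \<le> m" "N \<le> n" for x m n
  proof -
    let ?u = "\<lambda>x. g m x - g n x"
    have "cmod (partial_deriv i ?u x) \<le> 2 * (e * t / 8) / t + (2 * B') * t"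
    proof (rule norm_partial_deriv_interpolation[OF smooth_diff[OF g g] x t(1,2)])
      show "cmod (g m y - g n y) \<le> e * t / 8" if "y \<in> cball 0 (R + 1)" for y
        using N[OF that mn] by (simp add: dist_norm)
      show "cmod (partial_deriv i (partial_deriv i ?u) y) \<le> 2 * B'" if y: "y \<in> cball 0 (R + 1)" for y
        using iterated_partial_diff[OF g g, of "[i, i]" m n] bound[OF y, of m] bound[OF y, of n] B'
          norm_triangle_ineq4[of "partial_deriv i (partial_deriv i (g m)) y" "partial_deriv i (partial_deriv i (g n)) y"]
        by simp
    qed
    also have "\<dots> \<le> e / 4 + e / 4" using t by simp
    also have "\<dots> < e" using e by simp
    finally show ?thesis using iterated_partial_diff[OF g g, of "[i]" m n] by (simp add: dist_norm)
  qed
  then show "\<exists>M. \<forall>x\<in>cball 0 R. \<forall>m\<ge>M. \<forall>n\<ge>M. dist (partial_deriv i (g m) x) (partial_deriv i (g n) x) < e"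
    by blast
qed

text \<open>
  Interpolation propagates the Cauchy property from each derivative to the next, so all
  derivatives converge locally uniformly, and limits of derivatives are derivatives of limits.
\<close>

lemma smooth_limit:
  fixes g :: "nat \<Rightarrow> real^'n \<Rightarrow> complex"
  assumes g: "\<And>k. smooth (g k)"
    and bound: "\<And>R js. \<exists>B. \<forall>k. \<forall>y\<in>cball 0 R. cmod (iterated_partial js (g k) y) \<le> B"
    and Cauchy: "\<And>R. uniformly_Cauchy_on (cball 0 R) g"
  obtains G where "smooth G"
    "\<And>R js. uniform_limit (cball 0 R) (\<lambda>k. iterated_partial js (g k)) (iterated_partial js G) sequentially"
proof -
  have UC: "uniformly_Cauchy_on (cball 0 R) (\<lambda>k. iterated_partial js (g k))" for R js
  proof (induction js arbitrary: R)
    case Nil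
    then show ?case using Cauchy by simp
  next
    case (Cons i js)
    obtain B where B: "\<And>k y. y \<in> cball 0 (R + 1) \<Longrightarrow> cmod (iterated_partial (i # i # js) (g k) y) \<le> B"
      using bound by blast
    show ?case
      unfolding iterated_partial_Cons
      by (rule uniformly_Cauchy_on_partial_deriv[OF smooth_iterated_partial[OF g] _ Cons.IH]) (use B in simp)
  qed
  \<comment> \<open>The candidate for the derivative \<open>js\<close> of the limit \<open>D []\<close>.\<close>
  define D where "D js x = lim (\<lambda>k. iterated_partial js (g k) x)" for js x
  have ul: "uniform_limit (cball 0 R) (\<lambda>k. iterated_partial js (g k)) (D js) sequentially" for R js
    using Cauchy_uniformly_convergent[OF UC] by (simp add: uniformly_convergent_uniform_limit_iff D_def[abs_def])
  have lim: "(\<lambda>k. iterated_partial js (g k) x) \<longlonglongrightarrow> D js x" for js x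
    by (rule tendsto_uniform_limitI[OF ul[where R="norm x"]]) simp
  have deriv: "(D js has_derivative (\<lambda>h. \<Sum>i\<in>UNIV. (h $ i) *\<^sub>R D (i # js) x)) (at x)" for js x
  proof -
    let ?S = "ball 0 (norm x + 1) :: (real^'n) set"
    have "\<exists>G. \<forall>y\<in>?S. (\<lambda>k. iterated_partial js (g k) y) \<longlonglongrightarrow> G y \<and>
        (G has_derivative (\<lambda>h. \<Sum>i\<in>UNIV. (h $ i) *\<^sub>R D (i # js) y)) (at y within ?S)"
    proof (rule has_derivative_sequence)
      show "(iterated_partial js (g k) has_derivative
          (\<lambda>h. \<Sum>i\<in>UNIV. (h $ i) *\<^sub>R iterated_partial (i # js) (g k) y)) (at y within ?S)" for k y
        using has_derivative_partial_derivs[OF smooth_imp_differentiable[OF smooth_iterated_partial[OF g]]]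
        by (simp add: has_derivative_at_withinI)
      show "\<forall>\<^sub>F k in sequentially. \<forall>y\<in>?S. \<forall>h. norm ((\<Sum>i\<in>UNIV. (h $ i) *\<^sub>R iterated_partial (i # js) (g k) y)
          - (\<Sum>i\<in>UNIV. (h $ i) *\<^sub>R D (i # js) y)) \<le> e * norm h" if e: "e > 0" for e
      proof -
        let ?e = "e / real CARD('n)"
        have "?e > 0" using e by simp
        then have "\<forall>\<^sub>F k in sequentially. \<forall>y\<in>?S. dist (iterated_partial (i # js) (g k) y) (D (i # js) y) < ?e" for i
          using uniform_limitD[OF ul[where R="norm x + 1" and js="i # js"], of ?e]
          by (auto elim!: eventually_mono)
        then have "\<forall>\<^sub>F k in sequentially. \<forall>i. \<forall>y\<in>?S. dist (iterated_partial (i # js) (g k) y) (D (i # js) y) < ?e"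
          by (intro eventually_all_finite) auto
        then show ?thesis
        proof (rule eventually_mono, intro ballI allI)
          fix k y h
          assume k: "\<forall>i. \<forall>y\<in>?S. dist (iterated_partial (i # js) (g k) y) (D (i # js) y) < ?e" and y: "y \<in> ?S"
          have "norm ((\<Sum>i\<in>UNIV. (h $ i) *\<^sub>R iterated_partial (i # js) (g k) y) - (\<Sum>i\<in>UNIV. (h $ i) *\<^sub>R D (i # js) y))
              = norm (\<Sum>i\<in>UNIV. (h $ i) *\<^sub>R (iterated_partial (i # js) (g k) y - D (i # js) y))"
            by (simp only: sum_subtractf scaleR_right_diff_distrib)
          also have "\<dots> \<le> (\<Sum>i\<in>(UNIV :: 'n set). norm h * ?e)"
          proof (intro sum_norm_le)
            fix i
            have "dist (iterated_partial (i # js) (g k) y) (D (i # js) y) < ?e" using k y by blast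
            then show "norm ((h $ i) *\<^sub>R (iterated_partial (i # js) (g k) y - D (i # js) y)) \<le> norm h * ?e"
              unfolding norm_scaleR dist_norm using e
              by (intro mult_mono) (auto simp: component_le_norm_cart)
          qed
          also have "\<dots> = e * norm h" by simp
          finally show "norm ((\<Sum>i\<in>UNIV. (h $ i) *\<^sub>R iterated_partial (i # js) (g k) y)
            - (\<Sum>i\<in>UNIV. (h $ i) *\<^sub>R D (i # js) y)) \<le> e * norm h" .
        qed
      qed
      show "(\<lambda>k. iterated_partial js (g k) x) \<longlonglongrightarrow> D js x" by (rule lim)
    qed auto
    then obtain G where G: "\<And>y. y \<in> ?S \<Longrightarrow> (\<lambda>k. iterated_partial js (g k) y) \<longlonglongrightarrow> G y"
      "\<And>y. y \<in> ?S \<Longrightarrow> (G has_derivative (\<lambda>h. \<Sum>i\<in>UNIV. (h $ i) *\<^sub>R D (i # js) y)) (at y within ?S)"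
      by blast
    have x: "x \<in> ?S" by simp
    have "(G has_derivative (\<lambda>h. \<Sum>i\<in>UNIV. (h $ i) *\<^sub>R D (i # js) x)) (at x)"
      using G(2)[OF x] at_within_open[OF x open_ball] by simp
    then show ?thesis
      by (rule has_derivative_transform_within_open[OF _ open_ball x]) (use G(1) lim LIMSEQ_unique in blast)
  qed
  have partial: "partial_deriv i (D js) = D (i # js)" for i js
  proof
    fix x
    have "(\<Sum>j\<in>UNIV. (axis i 1 $ j) *\<^sub>R D (j # js) x) = D (i # js) x"
      by (simp add: axis_def if_distrib[of "\<lambda>r. r *\<^sub>R _"] cong: if_cong)
    then show "partial_deriv i (D js) x = D (i # js) x"
      using partial_deriv_eq_has_derivative[OF deriv] by simp
  qed
  have it: "iterated_partial js (D []) = D js" for js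
    by (induction js) (simp_all add: partial)
  have "smooth (D [])" unfolding smooth_def it using deriv by (auto simp: differentiable_def)
  with ul it show thesis by (intro that[of "D []"]) auto
qed

section \<open>Quadratic mean over balls\<close>

definition ball_energy :: "real \<Rightarrow> (real^'n \<Rightarrow> complex) \<Rightarrow> real" where
  "ball_energy R u = (LINT x|lborel. indicator (cball 0 R) x *\<^sub>R (cmod (u x))\<^sup>2)"

lemma integrable_ball_energy:
  fixes u :: "real^'n \<Rightarrow> complex"
  assumes "continuous_on UNIV u"
  shows "integrable lborel (\<lambda>x. indicator (cball 0 R) x *\<^sub>R (cmod (u x))\<^sup>2)"
  by (intro borel_integrable_compact continuous_intros continuous_on_subset[OF assms]) auto

lemma ball_energy_nonneg: "0 \<le> ball_energy R u"
  unfolding ball_energy_def by (intro integral_nonneg_AE) auto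

lemma ball_energy_le:
  fixes u :: "real^'n \<Rightarrow> complex"
  assumes "continuous_on UNIV u" and "\<And>x. x \<in> cball 0 R \<Longrightarrow> cmod (u x) \<le> b"
  shows "ball_energy R u \<le> b\<^sup>2 * measure lborel (cball (0 :: real^'n) R)"
proof -
  have "ball_energy R u \<le> (LINT x|(lborel :: (real^'n) measure). indicator (cball 0 R) x *\<^sub>R b\<^sup>2)"
    unfolding ball_energy_def
  proof (rule Bochner_Integration.integral_mono[OF integrable_ball_energy[OF assms(1)]])
    show "integrable lborel (\<lambda>x :: real^'n. indicator (cball 0 R) x *\<^sub>R b\<^sup>2)"
      by (intro borel_integrable_compact continuous_intros) auto
    show "indicator (cball 0 R) x *\<^sub>R (cmod (u x))\<^sup>2 \<le> indicator (cball 0 R) x *\<^sub>R b\<^sup>2" for x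
      using assms(2)[of x] by (auto simp: indicator_def power_mono)
  qed
  then show ?thesis by (simp add: mult.commute)
qed

text \<open>
  The strict convexity that forces minimizing sequences to converge.
\<close>

lemma ball_energy_parallelogram:
  fixes u v :: "real^'n \<Rightarrow> complex"
  assumes u: "continuous_on UNIV u" and v: "continuous_on UNIV v"
  shows "ball_energy R (\<lambda>x. (u x + v x) / 2) + ball_energy R (\<lambda>x. u x - v x) / 4
    = (ball_energy R u + ball_energy R v) / 2"
proof -
  have I: "integrable lborel (\<lambda>x. indicator (cball 0 R) x *\<^sub>R (cmod (w x))\<^sup>2)"
    if "continuous_on UNIV w" for w :: "real^'n \<Rightarrow> complex"
    by (rule integrable_ball_energy[OF that])
  have i1: "integrable lborel (\<lambda>x. indicator (cball 0 R) x *\<^sub>R (cmod ((u x + v x) / 2))\<^sup>2)"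
    by (rule I, intro continuous_intros u v, simp)
  have i2: "integrable lborel (\<lambda>x. indicator (cball 0 R) x *\<^sub>R (cmod (u x - v x))\<^sup>2)"
    by (rule I, intro continuous_intros u v)
  have par: "(cmod ((a + b) / 2))\<^sup>2 + (cmod (a - b))\<^sup>2 / 4 = ((cmod a)\<^sup>2 + (cmod b)\<^sup>2) / 2" for a b
    by (simp add: cmod_power2 norm_divide power_divide) (simp add: power2_eq_square field_simps)
  have "ball_energy R (\<lambda>x. (u x + v x) / 2) + ball_energy R (\<lambda>x. u x - v x) / 4 =
    (LINT x|lborel. indicator (cball 0 R) x *\<^sub>R (cmod ((u x + v x) / 2))\<^sup>2
      + (indicator (cball 0 R) x *\<^sub>R (cmod (u x - v x))\<^sup>2) / 4)"
    unfolding ball_energy_def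
    by (simp only: Bochner_Integration.integral_add[OF i1 integrable_divide[OF i2]] integral_divide_zero)
  also have "\<dots> = (LINT x|lborel. (indicator (cball 0 R) x *\<^sub>R (cmod (u x))\<^sup>2
      + indicator (cball 0 R) x *\<^sub>R (cmod (v x))\<^sup>2) / 2)"
  proof (rule Bochner_Integration.integral_cong[OF refl])
    fix x
    show "indicator (cball 0 R) x *\<^sub>R (cmod ((u x + v x) / 2))\<^sup>2 + (indicator (cball 0 R) x *\<^sub>R (cmod (u x - v x))\<^sup>2) / 4
      = (indicator (cball 0 R) x *\<^sub>R (cmod (u x))\<^sup>2 + indicator (cball 0 R) x *\<^sub>R (cmod (v x))\<^sup>2) / 2"
      using par[of "u x" "v x"] by (simp add: indicator_def)
  qed
  also have "\<dots> = (ball_energy R u + ball_energy R v) / 2"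
    unfolding ball_energy_def
    by (simp only: integral_divide_zero Bochner_Integration.integral_add[OF I[OF u] I[OF v]])
  finally show ?thesis .
qed

lemma ball_energy_orthogonal:
  fixes u :: "real^'n \<Rightarrow> complex" and T :: "real^'n \<Rightarrow> real^'n"
  assumes u: "continuous_on UNIV u" and T: "orthogonal_transformation T"
  shows "ball_energy R (\<lambda>x. u (T x)) = ball_energy R u"
proof -
  have [measurable]: "u \<in> borel_measurable borel" by (rule borel_measurable_continuous_onI[OF u])
  have [measurable]: "(indicator (cball 0 R) :: real^'n \<Rightarrow> real) \<in> borel_measurable borel"
    by (intro borel_measurable_indicator) auto
  have "indicator (cball 0 R) (T x) = (indicator (cball 0 R) x :: real)" for x
    using orthogonal_transformation_norm[OF T, of x] by (simp add: indicator_def)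
  then have "ball_energy R (\<lambda>x. u (T x)) = (LINT x|lborel. indicator (cball 0 R) (T x) *\<^sub>R (cmod (u (T x)))\<^sup>2)"
    by (simp add: ball_energy_def)
  also have "\<dots> = ball_energy R u"
    unfolding ball_energy_def by (rule integral_orthogonal[OF T]) measurable
  finally show ?thesis .
qed

lemma norm_diff_le_of_partial_derivs:
  fixes u :: "real^'n \<Rightarrow> complex"
  assumes u: "smooth u" and S: "convex S" "x \<in> S" "y \<in> S"
    and L: "\<And>i z. z \<in> S \<Longrightarrow> cmod (partial_deriv i u z) \<le> L"
  shows "cmod (u x - u y) \<le> real CARD('n) * L * norm (x - y)"
proof (rule differentiable_bound[OF S(1) _ _ S(2,3)])
  show "(u has_derivative (\<lambda>h. \<Sum>i\<in>UNIV. (h $ i) *\<^sub>R partial_deriv i u z)) (at z within S)" for z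
    by (rule has_derivative_at_withinI[OF has_derivative_partial_derivs[OF smooth_imp_differentiable[OF u]]])
  show "onorm (\<lambda>h. \<Sum>i\<in>UNIV. (h $ i) *\<^sub>R partial_deriv i u z) \<le> real CARD('n) * L" if "z \<in> S" for z
  proof (rule onorm_le)
    fix h :: "real^'n"
    have "norm (\<Sum>i\<in>UNIV. (h $ i) *\<^sub>R partial_deriv i u z) \<le> (\<Sum>i\<in>(UNIV :: 'n set). norm h * L)"
    proof (rule sum_norm_le)
      show "norm ((h $ i) *\<^sub>R partial_deriv i u z) \<le> norm h * L" for i
        unfolding norm_scaleR real_norm_def
        by (rule mult_mono[OF component_le_norm_cart L[OF that]]) simp_all
    qed
    then show "norm (\<Sum>i\<in>UNIV. (h $ i) *\<^sub>R partial_deriv i u z) \<le> real CARD('n) * L * norm h"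
      by (simp add: mult_ac)
  qed
qed

text \<open>
  If \<open>\<bar>u x\<bar> \<ge> \<epsilon>\<close>, the Lipschitz bound keeps \<open>\<bar>u\<bar> \<ge> \<epsilon> / 2\<close> on a ball around \<open>x\<close> whose radius does
  not depend on \<open>u\<close>, and this ball alone contributes a fixed amount \<open>\<delta>\<close> to the energy.
\<close>

lemma uniformly_small_of_ball_energy:
  assumes \<epsilon>: "\<epsilon> > 0"
  obtains \<delta> where "\<delta> > 0"
    "\<And>u x. \<lbrakk>smooth (u :: real^'n \<Rightarrow> complex); \<forall>i. \<forall>y\<in>cball 0 (R + 1). cmod (partial_deriv i u y) \<le> L;
       ball_energy (R + 1) u < \<delta>; x \<in> cball 0 R\<rbrakk> \<Longrightarrow> cmod (u x) < \<epsilon>"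
proof -
  define C where "C = real CARD('n) * max L 1"
  \<comment> \<open>Within distance \<open>\<rho>\<close> the value of \<open>u\<close> changes by at most \<open>\<epsilon> / 2\<close>.\<close>
  define \<rho> where "\<rho> = min 1 (\<epsilon> / (2 * C))"
  define \<delta> where "\<delta> = (\<epsilon> / 2)\<^sup>2 * (\<rho> ^ CARD('n) * measure lborel (ball (0 :: real^'n) 1))"
  have C: "C > 0" unfolding C_def by (intro mult_pos_pos) auto
  then have \<rho>: "\<rho> > 0" "\<rho> \<le> 1" "C * \<rho> \<le> \<epsilon> / 2" using \<epsilon> by (auto simp: \<rho>_def min_def field_simps)
  have "\<delta> > 0" unfolding \<delta>_def using \<epsilon> \<rho> content_ball_pos[of 1 "0 :: real^'n"] by simp
  moreover have "cmod (u x) < \<epsilon>"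
    if u: "smooth u" and L: "\<forall>i. \<forall>y\<in>cball 0 (R + 1). cmod (partial_deriv i u y) \<le> L"
      and small: "ball_energy (R + 1) u < \<delta>" and x: "x \<in> cball 0 R" for u :: "real^'n \<Rightarrow> complex" and x
  proof (rule ccontr)
    assume big: "\<not> cmod (u x) < \<epsilon>"
    have sub: "ball x \<rho> \<subseteq> cball 0 (R + 1)"
    proof
      fix y assume "y \<in> ball x \<rho>"
      then show "y \<in> cball 0 (R + 1)"
        using x \<rho>(2) dist_triangle[of 0 y x] unfolding mem_cball mem_ball by linarith
    qed
    have x': "x \<in> cball 0 (R + 1)" using x by auto
    have lower: "\<epsilon> / 2 \<le> cmod (u y)" if y: "y \<in> ball x \<rho>" for y
    proof -
      have "cmod (u x - u y) \<le> C * norm (x - y)"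
        unfolding C_def
      proof (rule norm_diff_le_of_partial_derivs[OF u convex_cball x'])
        show "y \<in> cball 0 (R + 1)" using y sub by (rule subsetD[rotated])
        show "cmod (partial_deriv i u z) \<le> max L 1" if "z \<in> cball 0 (R + 1)" for i z
          using L that by (simp add: le_max_iff_disj)
      qed
      also have "\<dots> \<le> C * \<rho>" using y C by (intro mult_left_mono) (auto simp: dist_norm)
      finally have "cmod (u x - u y) \<le> \<epsilon> / 2" using \<rho> by simp
      then show ?thesis using big norm_triangle_ineq2[of "u x" "u y"] by simp
    qed
    have "\<delta> = (\<epsilon> / 2)\<^sup>2 * measure lborel (ball x \<rho>)"
      using \<rho> by (simp add: \<delta>_def content_ball_conv_unit_ball[of \<rho> x])
    also have "\<dots> = (LINT y|lborel. indicator (ball x \<rho>) y *\<^sub>R (\<epsilon> / 2)\<^sup>2)"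
      by (simp add: mult.commute)
    also have "\<dots> \<le> ball_energy (R + 1) u"
      unfolding ball_energy_def
    proof (rule Bochner_Integration.integral_mono[OF _ integrable_ball_energy[OF smooth_imp_continuous_on[OF u]]])
      show "integrable lborel (\<lambda>y. indicator (ball x \<rho>) y *\<^sub>R (\<epsilon> / 2)\<^sup>2)"
        using emeasure_lborel_ball_finite[of x \<rho>] by (intro integrable_scaleR_left integrable_real_indicator) auto
      show "indicator (ball x \<rho>) y *\<^sub>R (\<epsilon> / 2)\<^sup>2 \<le> indicator (cball 0 (R + 1)) y *\<^sub>R (cmod (u y))\<^sup>2" for y
      proof (cases "y \<in> ball x \<rho>")
        case True
        then have "y \<in> cball 0 (R + 1)" using sub by (rule subsetD[rotated])
        moreover have "(\<epsilon> / 2)\<^sup>2 \<le> (cmod (u y))\<^sup>2" using \<epsilon> by (intro power_mono[OF lower[OF True]]) simp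
        ultimately show ?thesis using True by (simp only: indicator_simps scaleR_one)
      next
        case False
        then show ?thesis by (simp add: indicator_def)
      qed
    qed
    finally show False using small by simp
  qed
  ultimately show thesis by (rule that)
qed

section \<open>Minimizing sequences for midpoint-convex functionals\<close>

text \<open>
  The functionals \<open>E m\<close> are minimized simultaneously through their sum with weights \<open>a m\<close>
  that make it converge on \<open>H\<close>. Almost minimal points have an almost minimal midpoint, so by
  convexity their distance \<open>D m\<close> is small. Besides other members of the sequence, the point \<open>v\<close>
  may be anything with the same energies, such as a rotate of a member of the sequence.
\<close>

lemma minimizing_sequence:
  fixes H :: "'a set" and E :: "nat \<Rightarrow> 'a \<Rightarrow> real" and D :: "nat \<Rightarrow> 'a \<Rightarrow> 'a \<Rightarrow> real"
  assumes "H \<noteq> {}"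
    and mid: "\<And>u v. u \<in> H \<Longrightarrow> v \<in> H \<Longrightarrow> mid u v \<in> H"
    and E: "\<And>m u. 0 \<le> E m u" "\<And>m u. u \<in> H \<Longrightarrow> E m u \<le> C m"
    and D: "\<And>m u v. 0 \<le> D m u v"
    and convex: "\<And>m u v. u \<in> H \<Longrightarrow> v \<in> H \<Longrightarrow> E m (mid u v) + D m u v \<le> (E m u + E m v) / 2"
  shows "\<exists>g :: nat \<Rightarrow> 'a. (\<forall>k. g k \<in> H) \<and> (\<forall>m. \<forall>\<delta>>0. \<exists>N. \<forall>k\<ge>N. \<forall>l\<ge>N. \<forall>v\<in>H.
    (\<forall>m. E m v = E m (g l)) \<longrightarrow> D m (g k) v < \<delta>)"
proof -
  obtain u0 where u0: "u0 \<in> H" using \<open>H \<noteq> {}\<close> by blast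
  have C: "0 \<le> C m" for m using E(1)[of m u0] E(2)[OF u0, of m] by linarith
  \<comment> \<open>Dividing by \<open>1 + C m\<close> makes the weighted sum converge for every \<open>u \<in> H\<close>.\<close>
  define a where "a m = (1/2) ^ m / (1 + C m)" for m
  have a: "0 < a m" "a m * C m \<le> (1/2) ^ m" for m
    using C[of m] by (auto simp: a_def field_simps add_pos_nonneg)
  define J where "J u = (\<Sum>m. a m * E m u)" for u
  have summ: "summable (\<lambda>m. a m * x m)" if "\<And>m. 0 \<le> x m" "\<And>m. x m \<le> C m" for x
  proof (rule summable_comparison_test'[of "\<lambda>m. (1/2) ^ m" 0])
    show "summable (\<lambda>m. (1/2::real) ^ m)" by (simp add: summable_geometric)
    show "norm (a m * x m) \<le> (1/2) ^ m" for m
    proof -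
      have "norm (a m * x m) = a m * x m" using a(1)[of m] that(1)[of m] by simp
      also have "\<dots> \<le> a m * C m" using a(1)[of m] that(2)[of m] by simp
      finally show ?thesis using a(2)[of m] by linarith
    qed
  qed
  have summ_E: "summable (\<lambda>m. a m * E m u)" if "u \<in> H" for u
    by (rule summ[OF E(1) E(2)[OF that]])
  have J_nonneg: "0 \<le> J u" if "u \<in> H" for u
    unfolding J_def using a E(1) by (intro suminf_nonneg summ_E that) (simp add: less_imp_le)
  have D_le: "D m u v \<le> C m" if "u \<in> H" "v \<in> H" for m u v
    using convex[OF that, of m] E(1)[of m "mid u v"] E(2)[OF that(1), of m] E(2)[OF that(2), of m]
    by (simp add: field_simps)
  define d where "d = Inf (J ` H)"
  have bdd: "bdd_below (J ` H)" using J_nonneg by (intro bdd_belowI[of _ 0]) auto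
  have d_le: "d \<le> J u" if "u \<in> H" for u
    unfolding d_def using bdd that by (intro cInf_lower) auto
  have almost: "a m * D m u v < \<eta>" if uv: "u \<in> H" "v \<in> H" and J: "J u < d + \<eta>" "J v < d + \<eta>" for u v m \<eta>
  proof -
    have summ_D: "summable (\<lambda>m. a m * D m u v)" by (rule summ[OF D D_le[OF uv]])
    have "d + a m * D m u v \<le> J (mid u v) + (\<Sum>m. a m * D m u v)"
      using d_le[OF mid[OF uv]] sum_le_suminf[OF summ_D, of "{m}"] a(1) D
      by (simp add: less_imp_le)
    also have "\<dots> = (\<Sum>m. a m * E m (mid u v) + a m * D m u v)"
      unfolding J_def by (rule suminf_add[OF summ_E[OF mid[OF uv]] summ_D])
    also have "\<dots> \<le> (\<Sum>m. (a m * E m u + a m * E m v) / 2)"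
    proof (rule suminf_le)
      show "a m * E m (mid u v) + a m * D m u v \<le> (a m * E m u + a m * E m v) / 2" for m
        using mult_left_mono[OF convex[OF uv, of m], of "a m"] a(1)[of m] by (simp add: algebra_simps)
    qed (intro summable_add summable_divide summ_E summ_D mid uv)+
    also have "\<dots> = (J u + J v) / 2"
      unfolding J_def suminf_divide[OF summable_add[OF summ_E[OF uv(1)] summ_E[OF uv(2)]]]
        suminf_add[OF summ_E[OF uv(1)] summ_E[OF uv(2)]] ..
    finally show ?thesis using J by argo
  qed
  have "\<exists>u\<in>H. J u < d + 1 / real (Suc k)" for k
    using cInf_lessD[of "J ` H" "d + 1 / real (Suc k)"] \<open>H \<noteq> {}\<close> by (auto simp: d_def)
  then obtain g where g: "\<And>k. g k \<in> H" "\<And>k. J (g k) < d + 1 / real (Suc k)" by metis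
  have "\<exists>N. \<forall>k\<ge>N. \<forall>l\<ge>N. \<forall>v\<in>H. (\<forall>m. E m v = E m (g l)) \<longrightarrow> D m (g k) v < \<delta>"
    if "\<delta> > 0" for m \<delta>
  proof -
    from that have "0 < a m * \<delta>" using a(1)[of m] by simp
    then obtain N where N: "1 / real (Suc N) < a m * \<delta>" using nat_approx_posE by blast
    have "D m (g k) v < \<delta>" if "k \<ge> N" "l \<ge> N" "v \<in> H" "\<forall>m. E m v = E m (g l)" for k l v
    proof -
      have le: "1 / real (Suc j) \<le> 1 / real (Suc N)" if "j \<ge> N" for j
        using that by (simp add: frac_le)
      have "J v = J (g l)" using that by (simp add: J_def)
      then have "J (g k) < d + 1 / real (Suc N)" "J v < d + 1 / real (Suc N)"
        using g(2)[of k] g(2)[of l] le[OF \<open>k \<ge> N\<close>] le[OF \<open>l \<ge> N\<close>] by linarith+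
      from almost[OF g(1) \<open>v \<in> H\<close> this] have "a m * D m (g k) v < 1 / real (Suc N)" .
      with N have "a m * D m (g k) v < a m * \<delta>" by linarith
      then show ?thesis using a(1)[of m] by simp
    qed
    then show ?thesis by blast
  qed
  with g(1) show ?thesis by blast
qed

section \<open>The midpoint hull of the rotates of a function\<close>

lemma rotation_matrix_orthogonal_transformation:
  fixes T :: "real^'n^'n"
  assumes "rotation_matrix T"
  shows "orthogonal_transformation ((*v) T)"
  using assms by (simp add: orthogonal_transformation_matrix rotation_matrix_def)

lemma norm_rotation_matrix_vector_mult:
  fixes T :: "real^'n^'n"
  shows "rotation_matrix T \<Longrightarrow> norm (T *v x) = norm x"
  using orthogonal_transformation_norm[OF rotation_matrix_orthogonal_transformation] .

lemma rotation_matrix_entry_le: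
  fixes T :: "real^'n^'n"
  assumes "rotation_matrix T"
  shows "\<bar>T $ i $ j\<bar> \<le> 1"
proof -
  have "(T *v axis j 1) $ i = T $ i $ j" by (simp add: matrix_vector_mult_basis column_def)
  then show ?thesis
    using component_le_norm_cart[of "T *v axis j 1" i] norm_rotation_matrix_vector_mult[OF assms, of "axis j 1"]
    by simp
qed

lemma rotation_matrix_mult:
  fixes S T :: "real^'n^'n"
  shows "rotation_matrix S \<Longrightarrow> rotation_matrix T \<Longrightarrow> rotation_matrix (S ** T)"
  by (simp add: rotation_matrix_def orthogonal_matrix_mul det_mul)

lemma rotation_matrix_mat_1: "rotation_matrix (mat 1 :: real^'n^'n)"
  by (simp add: rotation_matrix_def orthogonal_matrix_id)

lemma rotation_matrix_inv:
  fixes T :: "real^'n^'n"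
  assumes "rotation_matrix T"
  shows "rotation_matrix (matrix_inv T)" "matrix_inv (matrix_inv T) = T"
proof -
  have inv: "matrix_inv Q = transpose Q" if "rotation_matrix Q" for Q :: "real^'n^'n"
  proof -
    have Q: "Q ** transpose Q = mat 1" "transpose Q ** Q = mat 1"
      using that by (simp_all add: rotation_matrix_def orthogonal_matrix_def)
    then have "Q ** matrix_inv Q = mat 1"
      unfolding matrix_inv_def using someI[of "\<lambda>B. Q ** B = mat 1 \<and> B ** Q = mat 1" "transpose Q"] by blast
    then have "transpose Q ** (Q ** matrix_inv Q) = transpose Q" by simp
    then show ?thesis by (simp only: matrix_mul_assoc Q matrix_mul_lid)
  qed
  have tr: "rotation_matrix (transpose T)"
    using assms by (simp add: rotation_matrix_def)
  show "rotation_matrix (matrix_inv T)" "matrix_inv (matrix_inv T) = T"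
    using inv[OF assms] inv[OF tr] tr by simp_all
qed

text \<open>
  Midpoints generate all the averages that the parallelogram argument requires. Rotations enter
  only at the base, so that the bounds below cost the factor \<open>n ^ p\<close> once and not once per rotation.
\<close>

inductive_set rotation_hull :: "(real^'n \<Rightarrow> complex) \<Rightarrow> (real^'n \<Rightarrow> complex) set"
  for \<phi> :: "real^'n \<Rightarrow> complex" where
  rotate: "rotation_matrix T \<Longrightarrow> (\<lambda>x. \<phi> (T *v x)) \<in> rotation_hull \<phi>"
| midpoint: "u \<in> rotation_hull \<phi> \<Longrightarrow> v \<in> rotation_hull \<phi> \<Longrightarrow> (\<lambda>x. (u x + v x) / 2) \<in> rotation_hull \<phi>"

lemma self_in_rotation_hull: "\<phi> \<in> rotation_hull \<phi>"
  using rotation_hull.rotate[OF rotation_matrix_mat_1, of \<phi>] by simp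

lemma rotation_hull_rotate:
  assumes "u \<in> rotation_hull \<phi>" "rotation_matrix T"
  shows "(\<lambda>x. u (T *v x)) \<in> rotation_hull \<phi>"
  using assms(1)
proof induction
  case (rotate S)
  have "(\<lambda>x. \<phi> ((S ** T) *v x)) \<in> rotation_hull \<phi>"
    by (intro rotation_hull.rotate rotation_matrix_mult rotate assms(2))
  then show ?case by (simp add: matrix_vector_mul_assoc)
next
  case (midpoint u v)
  then show ?case by (intro rotation_hull.midpoint)
qed

lemma iterated_partial_midpoint:
  "smooth u \<Longrightarrow> smooth v \<Longrightarrow> iterated_partial js (\<lambda>x. (u x + v x) / 2)
    = (\<lambda>x. (iterated_partial js u x + iterated_partial js v x) / 2)"
  using iterated_partial_linear[of u v js "1/2" "1/2"] by (simp add: add_divide_distrib)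

lemma rotation_hull_smooth:
  assumes "u \<in> rotation_hull \<phi>" "smooth \<phi>"
  shows "smooth u"
  using assms(1)
proof induction
  case (rotate T)
  show ?case by (rule smooth_matrix_vector_mult[OF assms(2) rotation_matrix_entry_le[OF rotate]])
next
  case (midpoint u v)
  then show ?case using smooth_linear[of u v "1/2" "1/2"] by (simp add: add_divide_distrib)
qed

lemma rotation_hull_bound:
  fixes \<phi> :: "real^'n \<Rightarrow> complex"
  assumes "u \<in> rotation_hull \<phi>" and \<phi>: "smooth \<phi>"
    and b: "\<And>ks y. length ks = length js \<Longrightarrow> y \<in> cball 0 R \<Longrightarrow> cmod (iterated_partial ks \<phi> y) \<le> b"
    and x: "x \<in> cball 0 R"
  shows "cmod (iterated_partial js u x) \<le> real CARD('n) ^ length js * b"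
  using assms(1)
proof induction
  case (rotate T)
  have "T *v x \<in> cball 0 R" using x by (simp add: norm_rotation_matrix_vector_mult[OF rotate])
  then show ?case
    by (intro norm_iterated_partial_matrix_vector_mult_le[OF \<phi> rotation_matrix_entry_le[OF rotate]] b)
next
  case (midpoint u v)
  have "cmod (iterated_partial js (\<lambda>x. (u x + v x) / 2) x)
      = cmod (iterated_partial js u x + iterated_partial js v x) / 2"
    using iterated_partial_midpoint[of u v js] midpoint.hyps rotation_hull_smooth[OF _ \<phi>]
    by (simp add: norm_divide)
  also have "\<dots> \<le> (cmod (iterated_partial js u x) + cmod (iterated_partial js v x)) / 2"
    by (intro divide_right_mono norm_triangle_ineq) simp
  also have "\<dots> \<le> real CARD('n) ^ length js * b"
    using add_mono[OF midpoint.IH] by (simp add: field_simps)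
  finally show ?case .
qed

lemma rotation_hull_spherical_mean:
  assumes "u \<in> rotation_hull \<phi>" and \<phi>: "smooth \<phi>"
  shows "spherical_mean u = spherical_mean \<phi>"
  using assms(1)
proof induction
  case (rotate T)
  show ?case
    by (rule spherical_mean_orthogonal[OF smooth_imp_continuous_on[OF \<phi>] rotation_matrix_orthogonal_transformation[OF rotate]])
next
  case (midpoint u v)
  then show ?case
    using spherical_mean_midpoint[of u v] by (simp add: smooth_imp_continuous_on rotation_hull_smooth[OF _ \<phi>])
qed

section \<open>Approximation of the spherical mean by averages of rotates\<close>

lemma smooth_bounded_on_cball:
  fixes \<phi> :: "real^'n \<Rightarrow> complex"
  assumes "smooth \<phi>"
  obtains b where "\<And>ks y. length ks = p \<Longrightarrow> y \<in> cball 0 R \<Longrightarrow> cmod (iterated_partial ks \<phi> y) \<le> b"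
proof -
  have "\<exists>b. \<forall>y\<in>cball 0 R. cmod (iterated_partial ks \<phi> y) \<le> b" for ks
  proof -
    have "compact (iterated_partial ks \<phi> ` cball 0 R)"
      by (intro compact_continuous_image compact_cball smooth_imp_continuous_on smooth_iterated_partial assms)
    then show ?thesis using compact_imp_bounded by (fastforce simp: bounded_iff)
  qed
  then obtain b where b: "\<And>ks y. y \<in> cball 0 R \<Longrightarrow> cmod (iterated_partial ks \<phi> y) \<le> b ks" by metis
  have fin: "finite {ks :: 'n list. length ks = p}"
    using finite_lists_length_eq[of "UNIV :: 'n set"] by simp
  show thesis
  proof (rule that)
    fix ks :: "'n list" and y assume ks: "length ks = p" and y: "y \<in> cball (0 :: real^'n) R"
    have "b ks \<le> Max (b ` {ks. length ks = p})" using fin ks by (intro Max_ge) auto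
    with b[OF y, of ks] show "cmod (iterated_partial ks \<phi> y) \<le> Max (b ` {ks. length ks = p})" by linarith
  qed
qed

lemma rotation_hull_uniform_bound:
  fixes \<phi> :: "real^'n \<Rightarrow> complex"
  assumes \<phi>: "smooth \<phi>"
  obtains B where "\<And>u js y. \<lbrakk>u \<in> rotation_hull \<phi>; length js = p; y \<in> cball 0 R\<rbrakk> \<Longrightarrow> cmod (iterated_partial js u y) \<le> B"
proof -
  obtain b where b: "\<And>ks y. length ks = p \<Longrightarrow> y \<in> cball 0 R \<Longrightarrow> cmod (iterated_partial ks \<phi> y) \<le> b"
    using smooth_bounded_on_cball[OF \<phi>] by blast
  show thesis
  proof (rule that)
    fix u js y assume "u \<in> rotation_hull \<phi>" and js: "length (js :: 'n list) = p" and "y \<in> cball (0 :: real^'n) R"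
    then show "cmod (iterated_partial js u y) \<le> real CARD('n) ^ p * b"
      using rotation_hull_bound[of u \<phi> js R b y] \<phi> b by simp
  qed
qed

text \<open>
  The minimizing sequence converges with all derivatives to a radial function. Passing to the
  limit in the spherical means, which are constant along the sequence, identifies this function.
\<close>

lemma spherical_mean_approximation:
  fixes \<phi> :: "real^'n \<Rightarrow> complex"
  assumes \<phi>: "smooth \<phi>" and n: "CARD('n) \<ge> 2"
  obtains g :: "nat \<Rightarrow> real^'n \<Rightarrow> complex" where "\<And>k. g k \<in> rotation_hull \<phi>" "smooth (spherical_mean \<phi>)"
    "\<And>R js. uniform_limit (cball 0 R) (\<lambda>k. iterated_partial js (g k)) (iterated_partial js (spherical_mean \<phi>)) sequentially"
proof -
  let ?H = "rotation_hull \<phi>"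
  let ?E = "\<lambda>(m::nat) (u :: real^'n \<Rightarrow> complex). ball_energy (real m) u"
  let ?D = "\<lambda>(m::nat) u v. ball_energy (real m) (\<lambda>x. u x - v x :: complex) / 4"
  have smH: "smooth u" if "u \<in> ?H" for u using rotation_hull_smooth[OF that \<phi>] .
  have contH: "continuous_on UNIV u" if "u \<in> ?H" for u
    using smooth_imp_continuous_on[OF smH[OF that]] .
  have "\<exists>B. \<forall>u\<in>?H. \<forall>js y. length js = p \<longrightarrow> y \<in> cball 0 R \<longrightarrow> cmod (iterated_partial js u y) \<le> B" for p R
  proof -
    obtain B where "\<And>u js y. \<lbrakk>u \<in> ?H; length js = p; y \<in> cball 0 R\<rbrakk> \<Longrightarrow> cmod (iterated_partial js u y) \<le> B"
      using rotation_hull_uniform_bound[OF \<phi>, of p R] by blast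
    then show ?thesis by blast
  qed
  then have "\<forall>p. \<exists>B. \<forall>R. \<forall>u\<in>?H. \<forall>js y. length js = p \<longrightarrow> y \<in> cball 0 R \<longrightarrow> cmod (iterated_partial js u y) \<le> B R"
    by (intro allI choice)
  from choice[OF this] obtain B where B: "\<And>R p u js y. u \<in> ?H \<Longrightarrow> length js = p \<Longrightarrow> y \<in> cball 0 R \<Longrightarrow>
      cmod (iterated_partial js u y) \<le> B p R"
    by blast
  have B0: "cmod (u y) \<le> B 0 R" if "u \<in> ?H" "y \<in> cball 0 R" for u R y
    using B[of u "[]" 0 y R] that by simp
  have "\<exists>g :: nat \<Rightarrow> real^'n \<Rightarrow> complex. (\<forall>k. g k \<in> ?H) \<and> (\<forall>m. \<forall>\<delta>>0. \<exists>N. \<forall>k\<ge>N. \<forall>l\<ge>N. \<forall>v\<in>?H.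
      (\<forall>m. ?E m v = ?E m (g l)) \<longrightarrow> ?D m (g k) v < \<delta>)"
  proof (rule minimizing_sequence[where H="?H" and mid="\<lambda>u v x. (u x + v x) / 2" and E="?E" and D="?D"
        and C="\<lambda>m. (B 0 (real m))\<^sup>2 * measure lborel (cball (0 :: real^'n) (real m))"])
    show "?H \<noteq> {}" using self_in_rotation_hull by blast
    show "(\<lambda>x. (u x + v x) / 2) \<in> ?H" if "u \<in> ?H" "v \<in> ?H" for u v
      using that by (rule rotation_hull.midpoint)
    show "0 \<le> ?E m u" for m u by (rule ball_energy_nonneg)
    show "?E m u \<le> (B 0 (real m))\<^sup>2 * measure lborel (cball (0 :: real^'n) (real m))" if "u \<in> ?H" for m u
      by (rule ball_energy_le[OF contH[OF that] B0[OF that]])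
    show "0 \<le> ?D m u v" for m and u v :: "real^'n \<Rightarrow> complex" using ball_energy_nonneg by simp
    show "?E m (\<lambda>x. (u x + v x) / 2) + ?D m u v \<le> (?E m u + ?E m v) / 2" if "u \<in> ?H" "v \<in> ?H" for m u v
      using ball_energy_parallelogram[OF contH[OF that(1)] contH[OF that(2)]] by (rule eq_refl)
  qed
  then obtain g :: "nat \<Rightarrow> real^'n \<Rightarrow> complex" where gH: "\<And>k. g k \<in> ?H" and
    g: "\<And>m \<delta>. \<delta> > 0 \<Longrightarrow> \<exists>N. \<forall>k\<ge>N. \<forall>l\<ge>N. \<forall>v\<in>?H. (\<forall>m. ?E m v = ?E m (g l)) \<longrightarrow> ?D m (g k) v < \<delta>"
    by blast
  \<comment> \<open>The abstract distance \<open>D m\<close> of the minimizing sequence turned into uniform distance on balls.\<close>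
  have close: "\<exists>N. \<forall>k\<ge>N. \<forall>l\<ge>N. \<forall>v\<in>?H. (\<forall>m. ?E m v = ?E m (g l)) \<longrightarrow> (\<forall>x\<in>cball 0 R. cmod (g k x - v x) < e)"
    if e: "e > 0" for R e
  proof -
    obtain m :: nat where m: "R + 1 \<le> real m" using real_arch_simple by blast
    obtain \<delta> where \<delta>: "\<delta> > 0" and small: "\<And>u x. \<lbrakk>smooth (u :: real^'n \<Rightarrow> complex);
        \<forall>i. \<forall>y\<in>cball 0 ((real m - 1) + 1). cmod (partial_deriv i u y) \<le> 2 * B 1 (real m);
        ball_energy ((real m - 1) + 1) u < \<delta>; x \<in> cball 0 (real m - 1)\<rbrakk> \<Longrightarrow> cmod (u x) < e"
      by (rule uniformly_small_of_ball_energy[OF e, of "real m - 1" "2 * B 1 (real m)", where 'n='n]) (rule that)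
    have "\<delta> / 4 > 0" using \<delta> by simp
    from g[OF this, of m] obtain N where N: "\<And>k l v. \<lbrakk>k \<ge> N; l \<ge> N; v \<in> ?H; \<forall>m. ?E m v = ?E m (g l)\<rbrakk> \<Longrightarrow> ?D m (g k) v < \<delta> / 4"
      by blast
    have "cmod (g k x - v x) < e"
      if kl: "k \<ge> N" "l \<ge> N" and v: "v \<in> ?H" and eq: "\<forall>m. ?E m v = ?E m (g l)" and x: "x \<in> cball 0 R" for k l v x
    proof (rule small[of "\<lambda>x. g k x - v x"])
      show "smooth (\<lambda>x. g k x - v x)" by (rule smooth_diff[OF smH[OF gH] smH[OF v]])
      show "\<forall>i. \<forall>y\<in>cball 0 ((real m - 1) + 1). cmod (partial_deriv i (\<lambda>x. g k x - v x) y) \<le> 2 * B 1 (real m)"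
      proof (intro allI ballI)
        fix i and y :: "real^'n" assume y: "y \<in> cball 0 ((real m - 1) + 1)"
        have y': "y \<in> cball 0 (real m)" using y by simp
        have diff: "partial_deriv i (\<lambda>x. g k x - v x) y = partial_deriv i (g k) y - partial_deriv i v y"
          using iterated_partial_diff[OF smH[OF gH] smH[OF v], of "[i]"] by simp
        have bd: "cmod (partial_deriv i w y) \<le> B 1 (real m)" if "w \<in> ?H" for w
          using B[OF that, of "[i]" 1 y] y' by simp
        show "cmod (partial_deriv i (\<lambda>x. g k x - v x) y) \<le> 2 * B 1 (real m)"
          unfolding diff using norm_triangle_ineq4[of "partial_deriv i (g k) y" "partial_deriv i v y"] bd[OF gH[of k]] bd[OF v]
          by simp
      qed
      show "ball_energy ((real m - 1) + 1) (\<lambda>x. g k x - v x) < \<delta>"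
        using N[OF kl v eq] by simp
      show "x \<in> cball 0 (real m - 1)" using x m by simp
    qed
    then show ?thesis by blast
  qed
  obtain G where G: "smooth G"
    "\<And>R js. uniform_limit (cball 0 R) (\<lambda>k. iterated_partial js (g k)) (iterated_partial js G) sequentially"
  proof (rule smooth_limit[of g])
    show "smooth (g k)" for k by (rule smH[OF gH])
    show "\<exists>B. \<forall>k. \<forall>y\<in>cball 0 R. cmod (iterated_partial js (g k) y) \<le> B" for R js
      using B[OF gH refl] by blast
    show "uniformly_Cauchy_on (cball 0 R) g" for R
    proof (rule uniformly_Cauchy_onI)
      fix e :: real assume "e > 0"
      from close[OF this, of R] show "\<exists>M. \<forall>x\<in>cball 0 R. \<forall>m\<ge>M. \<forall>n\<ge>M. dist (g m x) (g n x) < e"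
        using gH unfolding dist_norm by blast
    qed
  qed (rule that)
  have lim: "(\<lambda>k. g k x) \<longlonglongrightarrow> G x" for x
  proof -
    have "uniform_limit (cball 0 (norm x)) (\<lambda>k. iterated_partial [] (g k)) (iterated_partial [] G) sequentially"
      by (rule G(2))
    from tendsto_uniform_limitI[OF this, of x] show ?thesis by simp
  qed
  \<comment> \<open>Lebesgue measure is rotation invariant, so \<open>g k\<close> and its rotate have equal energies on all balls.\<close>
  have invariant: "G (T *v x) = G x" if T: "rotation_matrix T" for T x
  proof -
    have "(\<lambda>k. g k x - g k (T *v x)) \<longlonglongrightarrow> 0"
    proof (rule LIMSEQ_I)
      fix e :: real assume "e > 0"
      from close[OF this, of "norm x"] obtain N where N: "\<And>k l v y. \<lbrakk>k \<ge> N; l \<ge> N; v \<in> ?H;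
          \<forall>m. ?E m v = ?E m (g l); y \<in> cball 0 (norm x)\<rbrakk> \<Longrightarrow> cmod (g k y - v y) < e" by blast
      have "cmod (g k x - g k (T *v x)) < e" if "k \<ge> N" for k
        using N[OF that that rotation_hull_rotate[OF gH T], of k x]
          ball_energy_orthogonal[OF contH[OF gH] rotation_matrix_orthogonal_transformation[OF T]] by simp
      then show "\<exists>N. \<forall>k\<ge>N. norm (g k x - g k (T *v x) - 0) < e" by auto
    qed
    moreover have "(\<lambda>k. g k x - g k (T *v x)) \<longlonglongrightarrow> G x - G (T *v x)"
      by (intro tendsto_diff lim)
    ultimately have "G x - G (T *v x) = 0" by (rule LIMSEQ_unique[rotated])
    then show ?thesis by simp
  qed
  have radial: "G x = G y" if "norm x = norm y" for x y
  proof -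
    obtain f where f: "orthogonal_transformation f" "det (matrix f) = 1" "f x = y"
      using rotation_exists[OF n \<open>norm x = norm y\<close>] by blast
    then have "rotation_matrix (matrix f)" "matrix f *v x = y"
      by (auto simp: rotation_matrix_def orthogonal_transformation_matrix matrix_works)
    then show ?thesis using invariant by metis
  qed
  have mean_G: "spherical_mean G = G" by (rule spherical_mean_radial) (rule radial)
  have "spherical_mean \<phi> = G"
  proof
    fix x
    have "(\<lambda>k. spherical_mean (g k) x) \<longlonglongrightarrow> spherical_mean G x"
      using B0[OF gH, of _ "norm x"]
      by (intro spherical_mean_tendsto[where B="B 0 (norm x)"] contH gH smooth_imp_continuous_on G lim) simp
    then have "(\<lambda>k. spherical_mean \<phi> x) \<longlonglongrightarrow> G x"
      using rotation_hull_spherical_mean[OF gH \<phi>] mean_G by simp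
    then show "spherical_mean \<phi> x = G x" by (simp add: LIMSEQ_const_iff)
  qed
  with gH G show thesis by (intro that) auto
qed

section \<open>Membership and convergence in the spaces of ultradifferentiable functions\<close>

text \<open>
  The inequality \<open>\<parallel>\<phi>\<parallel> \<le> B\<close> for the norm of \<^const>\<open>ultra_step\<close>, with derivatives indexed by lists
  of directions instead of multi-indices.
\<close>

definition ultra_bound ::
    "(nat \<Rightarrow> real) \<Rightarrow> (real^'n) set \<Rightarrow> real \<Rightarrow> real \<Rightarrow> (real^'n \<Rightarrow> complex) \<Rightarrow> bool" where
  "ultra_bound M K h B \<phi> \<longleftrightarrow>
     (\<forall>x\<in>K. \<forall>js. cmod (iterated_partial js \<phi> x) \<le> B * (h ^ length js * M (length js)))"

lemma ultra_norm_le_iff: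
  fixes \<phi> :: "real^'n \<Rightarrow> complex"
  assumes M: "\<And>p. M p > 0" and "h > 0" "B \<ge> 0" "smooth \<phi>"
  shows "ultra_norm M K h \<phi> \<le> ennreal B \<longleftrightarrow> ultra_bound M K h B \<phi>"
proof -
  have pos: "h ^ p * M p > 0" for p using assms by simp
  have "ultra_norm M K h \<phi> \<le> ennreal B \<longleftrightarrow> (\<forall>x\<in>K. \<forall>\<alpha>.
      cmod (multi_deriv \<alpha> \<phi> x) \<le> B * (h ^ multi_order \<alpha> * M (multi_order \<alpha>)))"
    unfolding ultra_norm_def SUP_le_iff using \<open>B \<ge> 0\<close> pos by (simp add: pos_divide_le_eq)
  also have "\<dots> \<longleftrightarrow> ultra_bound M K h B \<phi>"
    unfolding ultra_bound_def
  proof (intro iffI ballI allI)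
    fix x js assume "\<forall>x\<in>K. \<forall>\<alpha>. cmod (multi_deriv \<alpha> \<phi> x) \<le> B * (h ^ multi_order \<alpha> * M (multi_order \<alpha>))" "x \<in> K"
    then show "cmod (iterated_partial js \<phi> x) \<le> B * (h ^ length js * M (length js))"
      by (simp only: iterated_partial_eq_multi_deriv(1)[OF \<open>smooth \<phi>\<close>, of js]
          iterated_partial_eq_multi_deriv(2)[OF \<open>smooth \<phi>\<close>, of js, symmetric])
  next
    fix x and \<alpha> :: "'n \<Rightarrow> nat" assume *: "\<forall>x\<in>K. \<forall>js. cmod (iterated_partial js \<phi> x) \<le> B * (h ^ length js * M (length js))" "x \<in> K"
    obtain js where js: "length js = multi_order \<alpha>" "\<And>f. multi_deriv \<alpha> f = iterated_partial js f"
      by (rule multi_deriv_eq_iterated_partial[of \<alpha>]) (rule that)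
    show "cmod (multi_deriv \<alpha> \<phi> x) \<le> B * (h ^ multi_order \<alpha> * M (multi_order \<alpha>))"
      unfolding js(2) js(1)[symmetric] using * by blast
  qed
  finally show ?thesis .
qed

lemma mem_ultra_step_space_iff:
  fixes \<phi> :: "real^'n \<Rightarrow> complex"
  assumes M: "\<And>p. M p > 0" and h: "h > 0"
  shows "\<phi> \<in> ultra_step_space M K h \<longleftrightarrow> smooth \<phi> \<and> (\<exists>B\<ge>0. ultra_bound M K h B \<phi>)"
proof (cases "smooth \<phi>")
  case True
  have "ultra_norm M K h \<phi> < \<infinity> \<longleftrightarrow> (\<exists>B\<ge>0. ultra_norm M K h \<phi> \<le> ennreal B)"
  proof
    assume "ultra_norm M K h \<phi> < \<infinity>"
    then show "\<exists>B\<ge>0. ultra_norm M K h \<phi> \<le> ennreal B"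
      by (cases "ultra_norm M K h \<phi>") auto
  next
    assume "\<exists>B\<ge>0. ultra_norm M K h \<phi> \<le> ennreal B"
    then show "ultra_norm M K h \<phi> < \<infinity>" using le_less_trans[of _ "ennreal _" \<infinity>] by auto
  qed
  then show ?thesis using True ultra_norm_le_iff[of M h _ \<phi> K, OF M h _ True] by (auto simp: ultra_step_space_def)
qed (simp add: ultra_step_space_def)

lemma ultra_bound_subset: "ultra_bound M K h B \<phi> \<Longrightarrow> K' \<subseteq> K \<Longrightarrow> ultra_bound M K' h B \<phi>"
  unfolding ultra_bound_def by blast

text \<open>
  The quantifier over the parameter \<open>h\<close> by which the inductive limit (Roumieu) and the
  projective limit (Beurling) differ.
\<close>

fun for_steps :: "ultra_case \<Rightarrow> (real \<Rightarrow> bool) \<Rightarrow> bool" where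
  "for_steps Roumieu P \<longleftrightarrow> (\<exists>h>0. P h)"
| "for_steps Beurling P \<longleftrightarrow> (\<forall>h>0. P h)"

text \<open>
  Both kinds of limit absorb a constant factor in \<open>h\<close>.
\<close>

lemma for_steps_rescale:
  assumes "for_steps star P" "c > 0" "\<And>h. h > 0 \<Longrightarrow> P h \<Longrightarrow> Q (c * h)"
  shows "for_steps star Q"
proof (cases star)
  case Roumieu
  then obtain h where "h > 0" "P h" using assms(1) by auto
  then have "c * h > 0" "Q (c * h)" using assms by auto
  then show ?thesis using Roumieu by auto
next
  case Beurling
  have "Q h" if "h > 0" for h
    using assms(3)[of "h / c"] assms(1,2) Beurling that by simp
  then show ?thesis using Beurling by simp
qed

lemma for_steps_mono: "for_steps star P \<Longrightarrow> (\<And>h. h > 0 \<Longrightarrow> P h \<Longrightarrow> Q h) \<Longrightarrow> for_steps star Q"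
  using for_steps_rescale[of star P 1 Q] by simp

lemma fat_compact_subset_cball:
  assumes "K \<in> fat_compacts"
  obtains R where "K \<subseteq> cball (0 :: real^'n) R"
proof -
  have "bounded K" using assms by (simp add: fat_compacts_def compact_imp_bounded)
  then obtain R where "\<And>x. x \<in> K \<Longrightarrow> norm x \<le> R" by (auto simp: bounded_iff)
  then have "K \<subseteq> cball 0 R" by auto
  then show thesis by (rule that)
qed

lemma mem_ultra_space_iff:
  fixes \<phi> :: "real^'n \<Rightarrow> complex"
  assumes M: "\<And>p. M p > 0"
  shows "\<phi> \<in> topspace (ultra_space star M) \<longleftrightarrow>
    smooth \<phi> \<and> (\<forall>R. for_steps star (\<lambda>h. \<exists>B\<ge>0. ultra_bound M (cball 0 R) h B \<phi>))"
proof -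
  have "\<phi> \<in> topspace (ultra_space star M) \<longleftrightarrow>
      (\<forall>K\<in>fat_compacts. for_steps star (\<lambda>h. \<phi> \<in> ultra_step_space M K h))"
    by (cases star) (auto simp: topspace_ultra_space[OF M] Bex_def simp del: ultra_space.simps)
  also have "\<dots> \<longleftrightarrow> smooth \<phi> \<and> (\<forall>R. for_steps star (\<lambda>h. \<exists>B\<ge>0. ultra_bound M (cball 0 R) h B \<phi>))" (is "?L \<longleftrightarrow> ?R")
  proof
    assume L: ?L
    have fat: "cball (0 :: real^'n) (max R 1) \<in> fat_compacts" for R
      by (simp add: fat_compacts_def)
    have "\<exists>h>0. \<phi> \<in> ultra_step_space M (cball 0 (max 1 1)) h"
      using bspec[OF L fat[of 1]] by (cases star) (auto intro: zero_less_one)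
    then have "smooth \<phi>" by (auto simp: ultra_step_space_def)
    moreover have "for_steps star (\<lambda>h. \<exists>B\<ge>0. ultra_bound M (cball 0 R) h B \<phi>)" for R
    proof (rule for_steps_mono[OF bspec[OF L fat[of R]]])
      fix h :: real assume "h > 0" "\<phi> \<in> ultra_step_space M (cball 0 (max R 1)) h"
      then show "\<exists>B\<ge>0. ultra_bound M (cball 0 R) h B \<phi>"
        using mem_ultra_step_space_iff[of M h \<phi>, OF M] ultra_bound_subset[of M _ h _ \<phi> "cball 0 R"]
          subset_cball[of R "max R 1" "0 :: real^'n"] max.cobounded1[of R 1] by metis
    qed
    ultimately show ?R by blast
  next
    assume R: ?R
    show ?L
    proof
      fix K :: "(real^'n) set" assume "K \<in> fat_compacts"
      then obtain R where sub: "K \<subseteq> cball 0 R" by (rule fat_compact_subset_cball)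
      have "for_steps star (\<lambda>h. \<exists>B\<ge>0. ultra_bound M (cball 0 R) h B \<phi>)" using R by blast
      then show "for_steps star (\<lambda>h. \<phi> \<in> ultra_step_space M K h)"
      proof (rule for_steps_mono)
        fix h :: real assume "h > 0" "\<exists>B\<ge>0. ultra_bound M (cball 0 R) h B \<phi>"
        then show "\<phi> \<in> ultra_step_space M K h"
          using mem_ultra_step_space_iff[of M h \<phi>, OF M] ultra_bound_subset[OF _ sub] R by blast
      qed
    qed
  qed
  finally show ?thesis .
qed

lemma proj_lim_eventually:
  assumes F: "\<And>i U. i \<in> I \<Longrightarrow> openin (F i) U \<Longrightarrow> l \<in> U \<Longrightarrow> \<forall>\<^sub>F k in sequentially. u k \<in> U"
    and u: "\<And>k i. i \<in> I \<Longrightarrow> u k \<in> topspace (F i)"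
    and U: "openin (proj_lim I F) U" "l \<in> U"
  shows "\<forall>\<^sub>F k in sequentially. u k \<in> U"
proof -
  have "generate_topology_on {U \<inter> (\<Inter>i\<in>I. topspace (F i)) | i U. i \<in> I \<and> openin (F i) U} U"
    using U(1) by (simp add: proj_lim_def openin_topology_generated_by_iff)
  then show ?thesis using U(2)
  proof (induction rule: generate_topology_on.induct)
    case (Int a b)
    then have "\<forall>\<^sub>F k in sequentially. u k \<in> a" "\<forall>\<^sub>F k in sequentially. u k \<in> b" by blast+
    then have "\<forall>\<^sub>F k in sequentially. u k \<in> a \<and> u k \<in> b" by (rule eventually_conj)
    then show ?case by simp
  next
    case (UN \<K>)
    then obtain a where a: "a \<in> \<K>" "l \<in> a" by blast
    have "\<forall>\<^sub>F k in sequentially. u k \<in> a" by (rule UN.IH[OF a])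
    then show ?case by (rule eventually_mono) (use a in blast)
  next
    case (Basis s)
    then obtain i U where s: "s = U \<inter> (\<Inter>i\<in>I. topspace (F i))" "i \<in> I" "openin (F i) U" by blast
    then have "\<forall>\<^sub>F k in sequentially. u k \<in> U" using Basis by (intro F) auto
    then show ?case by (rule eventually_mono) (use s(1) u in blast)
  qed simp
qed

text \<open>
  Convergence to zero in one step already implies convergence in the inductive limit.
\<close>

lemma ind_lim_eventually:
  assumes i: "i \<in> I" and F: "\<And>W. openin (F i) W \<Longrightarrow> (\<lambda>_. 0) \<in> W \<Longrightarrow> \<forall>\<^sub>F k in sequentially. u k \<in> W"
    and U: "openin (ind_lim I F) U" "(\<lambda>_. 0) \<in> U"
  shows "\<forall>\<^sub>F k in sequentially. u k \<in> U"
proof -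
  from U(1) have "\<forall>u\<in>U. \<exists>V. ind_lim_nhd0 I F V \<and> (\<forall>v\<in>V. (\<lambda>x. u x + v x) \<in> U)"
    unfolding openin_ind_lim by (rule conjunct2)
  from bspec[OF this U(2)] obtain V where V: "ind_lim_nhd0 I F V" "\<forall>v\<in>V. v \<in> U" by auto
  then obtain W where W: "openin (F i) W" "(\<lambda>_. 0) \<in> W" "W \<subseteq> V"
    using i unfolding ind_lim_nhd0_def by blast
  from F[OF W(1,2)] show ?thesis by (rule eventually_mono) (use V(2) W(3) in blast)
qed

lemma ultra_step_eventually:
  fixes u :: "nat \<Rightarrow> real^'n \<Rightarrow> complex"
  assumes M: "\<And>p. M p > 0" and h: "h > 0" and u: "\<And>k. smooth (u k)"
    and lim: "\<And>\<epsilon>. \<epsilon> > 0 \<Longrightarrow> \<forall>\<^sub>F k in sequentially. ultra_bound M K h \<epsilon> (u k)"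
    and W: "openin (ultra_step M K h) W" "(\<lambda>_. 0) \<in> W"
  shows "\<forall>\<^sub>F k in sequentially. u k \<in> W"
proof -
  from W(1) have "\<forall>\<phi>\<in>W. \<exists>\<epsilon>>0. \<forall>\<psi>\<in>ultra_step_space M K h.
      ultra_norm M K h (\<lambda>x. \<psi> x - \<phi> x) < ennreal \<epsilon> \<longrightarrow> \<psi> \<in> W"
    unfolding openin_ultra_step by (rule conjunct2)
  from bspec[OF this W(2)] obtain \<epsilon> where \<epsilon>: "\<epsilon> > 0"
    "\<And>\<psi>. \<psi> \<in> ultra_step_space M K h \<Longrightarrow> ultra_norm M K h \<psi> < ennreal \<epsilon> \<Longrightarrow> \<psi> \<in> W" by auto
  have "\<epsilon> / 2 > 0" using \<epsilon> by simp
  from lim[OF this] show ?thesis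
  proof (rule eventually_mono)
    fix k assume b: "ultra_bound M K h (\<epsilon> / 2) (u k)"
    have "ultra_norm M K h (u k) \<le> ennreal (\<epsilon> / 2)"
      using b ultra_norm_le_iff[of M h "\<epsilon> / 2" "u k" K, OF M h _ u] \<epsilon>(1) by simp
    also have "\<dots> < ennreal \<epsilon>" using \<epsilon>(1) by (simp add: ennreal_less_iff)
    finally have "ultra_norm M K h (u k) < ennreal \<epsilon>" .
    moreover have "u k \<in> ultra_step_space M K h"
      using b \<epsilon>(1) u mem_ultra_step_space_iff[of M h "u k" K, OF M h] by (metis half_gt_zero less_imp_le)
    ultimately show "u k \<in> W" by (intro \<epsilon>(2))
  qed
qed

text \<open>
  A sufficient condition for convergence to zero in the space of test functions. On a given ball
  it asks for a single \<open>h\<close> in the Roumieu case and for all \<open>h\<close> in the Beurling case.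
\<close>

lemma ultra_space_eventually:
  fixes u :: "nat \<Rightarrow> real^'n \<Rightarrow> complex"
  assumes M: "\<And>p. M p > 0" and u: "\<And>k. u k \<in> topspace (ultra_space star M)"
    and lim: "\<And>R. for_steps star (\<lambda>h. \<forall>\<epsilon>>0. \<forall>\<^sub>F k in sequentially. ultra_bound M (cball 0 R) h \<epsilon> (u k))"
    and U: "openin (ultra_space star M) U" "(\<lambda>_. 0) \<in> U"
  shows "\<forall>\<^sub>F k in sequentially. u k \<in> U"
proof -
  have sm: "smooth (u k)" for k using u mem_ultra_space_iff[of M, OF M] by blast
  have lim_K: "for_steps star (\<lambda>h. \<forall>W. openin (ultra_step M K h) W \<longrightarrow> (\<lambda>_. 0) \<in> W \<longrightarrow>
      (\<forall>\<^sub>F k in sequentially. u k \<in> W))" if K: "K \<in> fat_compacts" for K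
  proof -
    obtain R where sub: "K \<subseteq> cball 0 R" using K by (rule fat_compact_subset_cball)
    show ?thesis
    proof (rule for_steps_mono[OF lim[of R]], intro allI impI)
      fix h :: real and W
      assume h: "h > 0" and ev: "\<forall>\<epsilon>>0. \<forall>\<^sub>F k in sequentially. ultra_bound M (cball 0 R) h \<epsilon> (u k)"
        and W: "openin (ultra_step M K h) W" "(\<lambda>_. 0) \<in> W"
      show "\<forall>\<^sub>F k in sequentially. u k \<in> W"
      proof (rule ultra_step_eventually[OF M h sm _ W])
        show "\<forall>\<^sub>F k in sequentially. ultra_bound M K h \<epsilon> (u k)" if "\<epsilon> > 0" for \<epsilon>
          using ev that ultra_bound_subset[OF _ sub] by (auto elim!: eventually_mono)
      qed
    qed
  qed
  show ?thesis
  proof (cases star)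
    case Roumieu
    have U': "openin (proj_lim fat_compacts (\<lambda>K. ind_lim {0<..} (ultra_step M K))) U"
      using U(1) Roumieu by simp
    show ?thesis
    proof (rule proj_lim_eventually[OF _ _ U' U(2)])
      show "u k \<in> topspace (ind_lim {0<..} (ultra_step M K))" if "K \<in> fat_compacts" for k K
        using u[of k] that Roumieu by (simp add: topspace_proj_lim[OF fat_compacts_nonempty])
      show "\<forall>\<^sub>F k in sequentially. u k \<in> V"
        if "K \<in> fat_compacts" and V: "openin (ind_lim {0<..} (ultra_step M K)) V" "(\<lambda>_. 0) \<in> V" for K V
      proof -
        obtain h where h: "h > 0" "\<And>W. openin (ultra_step M K h) W \<Longrightarrow> (\<lambda>_. 0) \<in> W \<Longrightarrow> \<forall>\<^sub>F k in sequentially. u k \<in> W"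
          using lim_K[OF \<open>K \<in> fat_compacts\<close>] Roumieu by auto
        show ?thesis by (rule ind_lim_eventually[where i=h, OF _ h(2) V]) (use h(1) in auto)
      qed
    qed
  next
    case Beurling
    have ne: "{0::real<..} \<noteq> {}" by (simp add: greaterThan_non_empty)
    have U': "openin (proj_lim fat_compacts (\<lambda>K. proj_lim {0<..} (ultra_step M K))) U"
      using U(1) Beurling by simp
    show ?thesis
    proof (rule proj_lim_eventually[OF _ _ U' U(2)])
      show uK: "u k \<in> topspace (proj_lim {0<..} (ultra_step M K))" if "K \<in> fat_compacts" for k K
        using u[of k] that Beurling by (simp add: topspace_proj_lim[OF fat_compacts_nonempty])
      show "\<forall>\<^sub>F k in sequentially. u k \<in> V"
        if K: "K \<in> fat_compacts" and V: "openin (proj_lim {0<..} (ultra_step M K)) V" "(\<lambda>_. 0) \<in> V" for K V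
      proof (rule proj_lim_eventually[OF _ _ V])
        show "\<forall>\<^sub>F k in sequentially. u k \<in> W" if "h \<in> {0<..}" "openin (ultra_step M K h) W" "(\<lambda>_. 0) \<in> W" for h W
          using lim_K[OF K] Beurling that by auto
        show "u k \<in> topspace (ultra_step M K h)" if "h \<in> {0<..}" for k h
          using uK[OF K, of k] that by (simp add: topspace_proj_lim[OF ne])
      qed
    qed
  qed
qed

lemma top_dual_tendsto_0:
  fixes u :: "nat \<Rightarrow> real^'n \<Rightarrow> complex"
  assumes M: "\<And>p. M p > 0" and f: "f \<in> top_dual (ultra_space star M)"
    and u: "\<And>k. u k \<in> topspace (ultra_space star M)"
    and lim: "\<And>R. for_steps star (\<lambda>h. \<forall>\<epsilon>>0. \<forall>\<^sub>F k in sequentially. ultra_bound M (cball 0 R) h \<epsilon> (u k))"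
  shows "(\<lambda>k. f (u k)) \<longlonglongrightarrow> 0"
proof (rule topological_tendstoI)
  let ?X = "ultra_space star M :: (real^'n \<Rightarrow> complex) topology"
  fix S :: "complex set" assume S: "open S" "0 \<in> S"
  have hom: "\<And>c \<phi>. \<phi> \<in> topspace ?X \<Longrightarrow> f (\<lambda>x. c * \<phi> x) = c * f \<phi>" and cont: "continuous_map ?X euclidean f"
    using f unfolding top_dual_def by blast+
  have "iterated_partial js (\<lambda>_. 0) = (\<lambda>_. 0)" for js :: "'n list"
    by (induction js) (auto simp: partial_deriv_def)
  then have "ultra_bound M K h 0 (\<lambda>_. 0)" for K :: "(real^'n) set" and h
    by (simp add: ultra_bound_def)
  then have "\<exists>B\<ge>0. ultra_bound M K h B (\<lambda>_. 0)" for K :: "(real^'n) set" and h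
    by (intro exI[of _ 0]) simp
  then have "for_steps star (\<lambda>h. \<exists>B\<ge>0. ultra_bound M (cball (0 :: real^'n) R) h B (\<lambda>_. 0))" for R
    by (cases star) (auto intro: zero_less_one)
  moreover have "smooth (\<lambda>_ :: real^'n. 0)"
    using zero_in_ultra_step_space[of M "UNIV :: (real^'n) set" 1] by (simp add: ultra_step_space_def)
  ultimately have zero: "(\<lambda>_ :: real^'n. 0) \<in> topspace ?X"
    using mem_ultra_space_iff[of M "\<lambda>_ :: real^'n. 0" star, OF M] by blast
  have f0: "f (\<lambda>_. 0) = 0" using hom[OF zero, of 0] by simp
  have "openin ?X {\<phi> \<in> topspace ?X. f \<phi> \<in> S}"
    using cont S(1) by (intro openin_continuous_map_preimage[OF cont]) simp
  from ultra_space_eventually[OF M u lim this]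
  show "\<forall>\<^sub>F k in sequentially. f (u k) \<in> S"
    using zero f0 S(2) by (auto elim!: eventually_mono)
qed

section \<open>Rotation invariance and spherical means of functionals\<close>

lemma rotation_hull_ultra_bound:
  fixes \<phi> :: "real^'n \<Rightarrow> complex"
  assumes "smooth \<phi>" "ultra_bound M (cball 0 R) h B \<phi>" "u \<in> rotation_hull \<phi>"
  shows "ultra_bound M (cball 0 R) (real CARD('n) * h) B u"
  unfolding ultra_bound_def
proof (intro ballI allI)
  fix x and js :: "'n list" assume x: "x \<in> cball (0 :: real^'n) R"
  have "cmod (iterated_partial ks \<phi> y) \<le> B * (h ^ length js * M (length js))"
    if "length ks = length js" "y \<in> cball 0 R" for ks y
    using assms(2) that unfolding ultra_bound_def by metis
  then have "cmod (iterated_partial js u x) \<le> real CARD('n) ^ length js * (B * (h ^ length js * M (length js)))"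
    by (rule rotation_hull_bound[OF assms(3,1) _ x])
  then show "cmod (iterated_partial js u x) \<le> B * ((real CARD('n) * h) ^ length js * M (length js))"
    by (simp add: power_mult_distrib mult_ac)
qed

lemma rotation_hull_subset_ultra_space:
  fixes \<phi> :: "real^'n \<Rightarrow> complex"
  assumes M: "\<And>p. M p > 0" and \<phi>: "\<phi> \<in> topspace (ultra_space star M)" and u: "u \<in> rotation_hull \<phi>"
  shows "u \<in> topspace (ultra_space star M)"
proof -
  have sm: "smooth \<phi>" and b: "\<And>R. for_steps star (\<lambda>h. \<exists>B\<ge>0. ultra_bound M (cball 0 R) h B \<phi>)"
    using \<phi> mem_ultra_space_iff[of M \<phi> star, OF M] by blast+
  have "for_steps star (\<lambda>h. \<exists>B\<ge>0. ultra_bound M (cball 0 R) h B u)" for R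
    by (rule for_steps_rescale[OF b[of R], of "real CARD('n)"]) (use rotation_hull_ultra_bound[OF sm _ u] in auto)
  then show ?thesis
    using mem_ultra_space_iff[of M u star, OF M] rotation_hull_smooth[OF u sm] by blast
qed

text \<open>
  Relative to the weights of parameter \<open>2 * h\<close>, the derivatives of order \<open>p\<close> are at most
  \<open>B * (1/2) ^ p\<close>, hence below \<open>\<epsilon>\<close> beyond some order \<open>p0\<close>. For the finitely many derivatives of lower
  order uniform convergence suffices.
\<close>

lemma ultra_bound_tail_eventually:
  fixes u :: "nat \<Rightarrow> real^'n \<Rightarrow> complex"
  assumes M: "\<And>p. M p > 0" and h: "h > 0" and \<epsilon>: "\<epsilon> > 0"
    and b: "\<And>k. ultra_bound M K h B (u k)"
    and lim: "\<And>js. uniform_limit K (\<lambda>k. iterated_partial js (u k)) (\<lambda>_. 0) sequentially"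
  shows "\<forall>\<^sub>F k in sequentially. ultra_bound M K (2 * h) \<epsilon> (u k)"
proof -
  obtain p0 where p0: "B * (1/2) ^ p \<le> \<epsilon>" if "p \<ge> p0" for p
  proof -
    have "(\<lambda>p. B * (1/2) ^ p) \<longlonglongrightarrow> B * 0"
      by (intro tendsto_mult_left LIMSEQ_realpow_zero) auto
    then have "\<forall>\<^sub>F p in sequentially. B * (1/2) ^ p < \<epsilon>"
      using \<epsilon> by (intro order_tendstoD) auto
    then show thesis using that unfolding eventually_sequentially by (meson less_imp_le)
  qed
  have "\<forall>\<^sub>F k in sequentially. \<forall>x\<in>K. cmod (iterated_partial js (u k) x) \<le> \<epsilon> * ((2 * h) ^ length js * M (length js))"
    for js
  proof -
    have "\<epsilon> * ((2 * h) ^ length js * M (length js)) > 0" using \<epsilon> h M by simp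
    from uniform_limitD[OF lim[of js] this] show ?thesis
      by (rule eventually_mono) (auto simp: dist_norm less_imp_le)
  qed
  moreover have "finite {js :: 'n list. length js \<le> p0}"
    using finite_lists_length_le[of "UNIV :: 'n set" p0] by simp
  ultimately have "\<forall>\<^sub>F k in sequentially. \<forall>js\<in>{js. length js \<le> p0}. \<forall>x\<in>K.
      cmod (iterated_partial js (u k) x) \<le> \<epsilon> * ((2 * h) ^ length js * M (length js))"
    by (rule eventually_ball_finite[rotated, OF ballI])
  then show ?thesis
  proof (rule eventually_mono)
    fix k assume low: "\<forall>js\<in>{js. length js \<le> p0}. \<forall>x\<in>K.
      cmod (iterated_partial js (u k) x) \<le> \<epsilon> * ((2 * h) ^ length js * M (length js))"
    show "ultra_bound M K (2 * h) \<epsilon> (u k)"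
      unfolding ultra_bound_def
    proof (intro ballI allI)
      fix x and js :: "'n list" assume x: "x \<in> K"
      show "cmod (iterated_partial js (u k) x) \<le> \<epsilon> * ((2 * h) ^ length js * M (length js))"
      proof (cases "length js \<le> p0")
        case True
        then show ?thesis using low x by blast
      next
        case False
        let ?p = "length js"
        have "cmod (iterated_partial js (u k) x) \<le> B * (h ^ ?p * M ?p)"
          using b x unfolding ultra_bound_def by blast
        also have "\<dots> = (B * (1/2) ^ ?p) * ((2 * h) ^ ?p * M ?p)"
          by (simp add: power_mult_distrib power_divide)
        also have "\<dots> \<le> \<epsilon> * ((2 * h) ^ ?p * M ?p)"
          using p0[of ?p] False h M[of ?p] by (intro mult_right_mono) (auto simp: less_imp_le)
        finally show ?thesis .
      qed
    qed
  qed
qed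

text \<open>
  The limit inherits the bounds that hold uniformly on the rotation hull, so it belongs to the
  space, and the differences \<open>g k - spherical_mean \<phi>\<close> tend to zero there.
\<close>

lemma spherical_mean_hull_limit:
  fixes \<phi> :: "real^'n \<Rightarrow> complex"
  assumes n: "CARD('n) \<ge> 2" and M: "\<And>p. M p > 0"
    and \<phi>: "\<phi> \<in> topspace (ultra_space star M)" and f: "f \<in> top_dual (ultra_space star M)"
  shows "spherical_mean \<phi> \<in> topspace (ultra_space star M)"
    and "\<exists>g. (\<forall>k. g k \<in> rotation_hull \<phi>) \<and> (\<lambda>k. f (g k)) \<longlonglongrightarrow> f (spherical_mean \<phi>)"
proof -
  let ?X = "ultra_space star M :: (real^'n \<Rightarrow> complex) topology" and ?G = "spherical_mean \<phi>" and ?N = "real CARD('n)"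
  have sm: "smooth \<phi>" and b: "\<And>R. for_steps star (\<lambda>h. \<exists>B\<ge>0. ultra_bound M (cball 0 R) h B \<phi>)"
    using \<phi> mem_ultra_space_iff[of M \<phi> star, OF M] by blast+
  obtain g :: "nat \<Rightarrow> real^'n \<Rightarrow> complex" where gH: "\<And>k. g k \<in> rotation_hull \<phi>" and smG: "smooth ?G" and
    lim: "\<And>R js. uniform_limit (cball 0 R) (\<lambda>k. iterated_partial js (g k)) (iterated_partial js ?G) sequentially"
    by (rule spherical_mean_approximation[OF sm n]) (rule that)
  have smg: "smooth (g k)" for k by (rule rotation_hull_smooth[OF gH sm])
  have G_bound: "ultra_bound M (cball 0 R) h B ?G" if "\<And>k. ultra_bound M (cball 0 R) h B (g k)" for R h B
    unfolding ultra_bound_def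
  proof (intro ballI allI)
    fix x and js :: "'n list" assume x: "x \<in> cball (0 :: real^'n) R"
    have "(\<lambda>k. cmod (iterated_partial js (g k) x)) \<longlonglongrightarrow> cmod (iterated_partial js ?G x)"
      by (intro tendsto_norm tendsto_uniform_limitI[OF lim x])
    then show "cmod (iterated_partial js ?G x) \<le> B * (h ^ length js * M (length js))"
      by (rule LIMSEQ_le_const2) (use that x in \<open>auto simp: ultra_bound_def\<close>)
  qed
  have "for_steps star (\<lambda>h. \<exists>B\<ge>0. ultra_bound M (cball 0 R) h B ?G)" for R
    by (rule for_steps_rescale[OF b[of R], of ?N])
       (use G_bound[OF rotation_hull_ultra_bound[OF sm _ gH]] in \<open>auto\<close>)
  then show G: "?G \<in> topspace ?X"
    using mem_ultra_space_iff[of M ?G star, OF M] smG by blast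
  define u where "u k = (\<lambda>x. g k x - ?G x)" for k
  have it_u: "iterated_partial js (u k) = (\<lambda>x. iterated_partial js (g k) x - iterated_partial js ?G x)" for js k
    unfolding u_def by (rule iterated_partial_diff[OF smg smG])
  have u_bound: "ultra_bound M (cball 0 R) (?N * h) (2 * B) (u k)" if B: "ultra_bound M (cball 0 R) h B \<phi>" for R h B k
    unfolding ultra_bound_def it_u
  proof (intro ballI allI)
    fix x and js :: "'n list" assume x: "x \<in> cball (0 :: real^'n) R"
    have gB: "ultra_bound M (cball 0 R) (?N * h) B (g k)" for k
      by (rule rotation_hull_ultra_bound[OF sm B gH])
    have "cmod (iterated_partial js (g k) x) \<le> B * ((?N * h) ^ length js * M (length js))"
      "cmod (iterated_partial js ?G x) \<le> B * ((?N * h) ^ length js * M (length js))"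
      using gB[of k] G_bound[OF gB] x unfolding ultra_bound_def by blast+
    then have "cmod (iterated_partial js (g k) x - iterated_partial js ?G x)
        \<le> B * ((?N * h) ^ length js * M (length js)) + B * ((?N * h) ^ length js * M (length js))"
      by (rule norm_triangle_le_diff[OF add_mono])
    then show "cmod (iterated_partial js (g k) x - iterated_partial js ?G x) \<le> 2 * B * ((?N * h) ^ length js * M (length js))"
      by (simp only: mult_2 distrib_right)
  qed
  have u_lim: "uniform_limit (cball 0 R) (\<lambda>k. iterated_partial js (u k)) (\<lambda>_. 0) sequentially" for R js
  proof -
    have "uniform_limit (cball 0 R) (\<lambda>k x. iterated_partial js (g k) x - iterated_partial js ?G x)
        (\<lambda>x. iterated_partial js ?G x - iterated_partial js ?G x) sequentially"
      by (intro uniform_limit_intros lim)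
    then show ?thesis by (simp add: it_u)
  qed
  have u_X: "u k \<in> topspace ?X" for k
  proof -
    have "for_steps star (\<lambda>h. \<exists>B\<ge>0. ultra_bound M (cball 0 R) h B (u k))" for R
    proof (rule for_steps_rescale[OF b[of R], of ?N])
      fix h :: real assume "\<exists>B\<ge>0. ultra_bound M (cball 0 R) h B \<phi>"
      then obtain B where "B \<ge> 0" "ultra_bound M (cball 0 R) h B \<phi>" by blast
      then have "2 * B \<ge> 0" "ultra_bound M (cball 0 R) (?N * h) (2 * B) (u k)" using u_bound by simp_all
      then show "\<exists>B\<ge>0. ultra_bound M (cball 0 R) (?N * h) B (u k)" by blast
    qed simp
    moreover have "smooth (u k)" unfolding u_def by (rule smooth_diff[OF smg smG])
    ultimately show ?thesis using mem_ultra_space_iff[of M "u k" star, OF M] by blast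
  qed
  have "(\<lambda>k. f (u k)) \<longlonglongrightarrow> 0"
  proof (rule top_dual_tendsto_0[OF M f u_X])
    show "for_steps star (\<lambda>h. \<forall>\<epsilon>>0. \<forall>\<^sub>F k in sequentially. ultra_bound M (cball 0 R) h \<epsilon> (u k))" for R
    proof (rule for_steps_rescale[OF b[of R], of "2 * ?N"])
      fix h :: real assume h: "h > 0" and "\<exists>B\<ge>0. ultra_bound M (cball 0 R) h B \<phi>"
      then obtain B where "ultra_bound M (cball 0 R) h B \<phi>" by blast
      then have B: "\<And>k. ultra_bound M (cball 0 R) (?N * h) (2 * B) (u k)" by (rule u_bound)
      have "?N * h > 0" using h by simp
      then have "\<forall>\<^sub>F k in sequentially. ultra_bound M (cball 0 R) (2 * (?N * h)) \<epsilon> (u k)" if "\<epsilon> > 0" for \<epsilon>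
        by (rule ultra_bound_tail_eventually[OF M _ that B u_lim])
      then show "\<forall>\<epsilon>>0. \<forall>\<^sub>F k in sequentially. ultra_bound M (cball 0 R) (2 * ?N * h) \<epsilon> (u k)"
        by (simp add: mult.assoc)
    qed simp
  qed
  moreover have "f (g k) = f ?G + f (u k)" for k
  proof -
    have "f (\<lambda>x. ?G x + u k x) = f ?G + f (u k)"
      using f G u_X[of k] unfolding top_dual_def by blast
    then show ?thesis by (simp add: u_def)
  qed
  ultimately have "(\<lambda>k. f (g k)) \<longlonglongrightarrow> f ?G"
    using tendsto_add[OF tendsto_const[of "f ?G"], of "\<lambda>k. f (u k)" 0] by simp
  with gH show "\<exists>g. (\<forall>k. g k \<in> rotation_hull \<phi>) \<and> (\<lambda>k. f (g k)) \<longlonglongrightarrow> f ?G" by blast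
qed

lemma rotation_invariant_const_on_hull:
  fixes \<phi> :: "real^'n \<Rightarrow> complex"
  assumes M: "\<And>p. M p > 0" and f: "f \<in> top_dual (ultra_space star M)"
    and inv: "rotation_invariant (ultra_space star M) f"
    and \<phi>: "\<phi> \<in> topspace (ultra_space star M)" and "u \<in> rotation_hull \<phi>"
  shows "f u = f \<phi>"
  using assms(5)
proof induction
  case (rotate T)
  have "f \<phi> = f (\<lambda>x. \<phi> (matrix_inv (matrix_inv T) *v x))"
    using inv \<phi> rotation_matrix_inv(1)[OF rotate] unfolding rotation_invariant_def by blast
  then show ?case by (simp add: rotation_matrix_inv(2)[OF rotate])
next
  case (midpoint u v)
  let ?X = "ultra_space star M :: (real^'n \<Rightarrow> complex) topology"
  have uv: "u \<in> topspace ?X" "v \<in> topspace ?X" "(\<lambda>x. (u x + v x) / 2) \<in> topspace ?X"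
    by (intro rotation_hull_subset_ultra_space[OF M \<phi>] rotation_hull.midpoint midpoint.hyps)+
  have add: "\<And>\<phi> \<psi>. \<phi> \<in> topspace ?X \<Longrightarrow> \<psi> \<in> topspace ?X \<Longrightarrow> f (\<lambda>x. \<phi> x + \<psi> x) = f \<phi> + f \<psi>"
    and hom: "\<And>c \<phi>. \<phi> \<in> topspace ?X \<Longrightarrow> f (\<lambda>x. c * \<phi> x) = c * f \<phi>"
    using f unfolding top_dual_def by blast+
  have "2 * f (\<lambda>x. (u x + v x) / 2) = f (\<lambda>x. 2 * ((u x + v x) / 2))"
    by (rule hom[OF uv(3), symmetric])
  also have "\<dots> = f (\<lambda>x. u x + v x)" by (intro arg_cong[of _ _ f] ext) (simp add: field_simps)
  also have "\<dots> = f u + f v" by (rule add[OF uv(1,2)])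
  finally show ?case using midpoint.IH by simp
qed

theorem theorem3:
  fixes M :: "nat \<Rightarrow> real"
    and star :: ultra_case
    and f :: "(real^'n \<Rightarrow> complex) \<Rightarrow> complex"
  assumes "CARD('n) \<ge> 2"
    and "\<And>p. M p > 0"
    and "M 0 = 1"
    and "M0 star M"
    and "M1 M"
    and "M2' M"
    and "f \<in> top_dual (ultra_space star M)"
  shows "rotation_invariant (ultra_space star M) f \<longleftrightarrow>
         f = spherical_mean_functional (ultra_space star M) f"
proof
  let ?X = "ultra_space star M :: (real^'n \<Rightarrow> complex) topology"
  note M = assms(2) and f = assms(7)
  assume inv: "rotation_invariant ?X f"
  show "f = spherical_mean_functional ?X f"
  proof
    fix \<phi>
    show "f \<phi> = spherical_mean_functional ?X f \<phi>"
    proof (cases "\<phi> \<in> topspace ?X")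
      case True
      obtain g where g: "\<And>k. g k \<in> rotation_hull \<phi>" "(\<lambda>k. f (g k)) \<longlonglongrightarrow> f (spherical_mean \<phi>)"
        using spherical_mean_hull_limit(2)[OF assms(1) M True f] by blast
      have "f (g k) = f \<phi>" for k by (rule rotation_invariant_const_on_hull[OF M f inv True g(1)])
      with g(2) have "(\<lambda>_. f \<phi>) \<longlonglongrightarrow> f (spherical_mean \<phi>)" by (simp only:)
      then have "f \<phi> = f (spherical_mean \<phi>)" by (simp only: LIMSEQ_const_iff)
      then show ?thesis unfolding spherical_mean_functional_def restrict_apply'[OF True] .
    next
      case False
      have "f \<in> extensional (topspace ?X)" using f unfolding top_dual_def by blast
      then have "f \<phi> = undefined" using False by (rule extensional_arb)
      then show ?thesis using False by (simp only: spherical_mean_functional_def restrict_def if_False)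
    qed
  qed
next
  let ?X = "ultra_space star M :: (real^'n \<Rightarrow> complex) topology"
  note M = assms(2) and f = assms(7)
  assume mean: "f = spherical_mean_functional ?X f"
  have eval: "f \<psi> = f (spherical_mean \<psi>)" if "\<psi> \<in> topspace ?X" for \<psi>
  proof -
    have "f \<psi> = spherical_mean_functional ?X f \<psi>" by (rule fun_cong[OF mean])
    also have "\<dots> = f (spherical_mean \<psi>)"
      unfolding spherical_mean_functional_def by (rule restrict_apply'[OF that])
    finally show ?thesis .
  qed
  show "rotation_invariant ?X f"
    unfolding rotation_invariant_def
  proof (intro allI impI ballI)
    fix T :: "real^'n^'n" and \<phi> assume T: "rotation_matrix T" and \<phi>: "\<phi> \<in> topspace ?X"
    let ?\<psi> = "\<lambda>x. \<phi> (matrix_inv T *v x)"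
    have hull: "?\<psi> \<in> rotation_hull \<phi>"
      by (rule rotation_hull.rotate[OF rotation_matrix_inv(1)[OF T]])
    have "smooth \<phi>" using \<phi> mem_ultra_space_iff[of M \<phi> star, OF M] by blast
    then have "spherical_mean ?\<psi> = spherical_mean \<phi>" by (rule rotation_hull_spherical_mean[OF hull])
    then show "f \<phi> = f ?\<psi>"
      using eval[OF \<phi>] eval[OF rotation_hull_subset_ultra_space[OF M \<phi> hull]] by (simp only:)
  qed
qed

end
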